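(* For all positive integers $k,p,r$ with $p<2\lfloor\sqrt k\rfloor$, there exists a $k$-plane graph $G$ that has a unique minimum vertex cut $S$, with $|S|=p$, such that $d_F(s_1,s_2)\ge r$ in $\Lambda(G)$ for any two distinct vertices $s_1,s_2\in S$.
   Context: A drawing of a graph maps the vertices to distinct points of the plane and each edge to a curve (a homeomorphic image of $[0,1]$) joining the images of its endpoints whose interior contains no vertex. A crossing is a point interior to two distinct edges; no third edge passes through it, and the two edges cross transversally there. An embedded graph is a graph with such a drawing; it is $k$-plane if every edge contains at most $k$ crossing points and no two edge-curves share more than one point. The planarization $G^\times$ is obtained by inserting a dummy-vertex at every crossing point; $\Lambda(G)$ is obtained from $G^\times$ by inserting inside each face of $G^\times$ a face-vertex adjacent to all vertices of $G^\times$ on that face's boundary; the radial graph $R(G)$ is the subgraph of $\Lambda(G)$ formed by all edges incident to face-vertices; the face-distance $d_F(u,v)$ is the number of face-vertices on a shortest $u$–$v$ path in $R(G)$. A vertex cut is a set $S\subseteq V(G)$ whose removal disconnects $G$; a minimum vertex cut is one of minimum size. *)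

theory Defs
  imports "HOL-Analysis.Analysis"
begin

text \<open>Finite simple graphs on natural-number vertices: vertex set V, edge set E of 2-subsets.
A drawing: vertex positions pos in the plane (complex numbers), and for every edge e a curve
gam e : [0,1] -> plane.\<close>

definition simple_graph :: "nat set \<Rightarrow> nat set set \<Rightarrow> bool" where
  "simple_graph V E \<longleftrightarrow> finite V \<and> (\<forall>e\<in>E. \<exists>u v. u \<in> V \<and> v \<in> V \<and> u \<noteq> v \<and> e = {u, v})"

definition edge_interior :: "(nat set \<Rightarrow> real \<Rightarrow> complex) \<Rightarrow> nat set \<Rightarrow> complex set" where
  "edge_interior gam e = gam e ` {0<..<1}"

definition crossing_points :: "nat set set \<Rightarrow> (nat set \<Rightarrow> real \<Rightarrow> complex) \<Rightarrow> complex set" where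
  "crossing_points E gam =
     {c. \<exists>e1\<in>E. \<exists>e2\<in>E. e1 \<noteq> e2 \<and> c \<in> edge_interior gam e1 \<and> c \<in> edge_interior gam e2}"

text \<open>Transversal crossing of two curves at c: locally the pair of curves looks like the two
coordinate axes (a homeomorphism of a neighbourhood of c onto the unit disc sends c to 0,
the first curve to the real diameter and the second to the imaginary diameter).\<close>
definition crosses_transversally :: "complex set \<Rightarrow> complex set \<Rightarrow> complex \<Rightarrow> bool" where
  "crosses_transversally A B c \<longleftrightarrow>
     (\<exists>U h h'. open U \<and> c \<in> U \<and> homeomorphism U (ball 0 1) h h' \<and> h c = 0 \<and>
        h ` (U \<inter> A) = {z \<in> ball 0 1. Im z = 0} \<and>
        h ` (U \<inter> B) = {z \<in> ball 0 1. Re z = 0})"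

definition drawing :: "nat set \<Rightarrow> nat set set \<Rightarrow> (nat \<Rightarrow> complex) \<Rightarrow> (nat set \<Rightarrow> real \<Rightarrow> complex) \<Rightarrow> bool" where
  "drawing V E pos gam \<longleftrightarrow>
     simple_graph V E \<and>
     inj_on pos V \<and>
     (\<forall>e\<in>E. arc (gam e) \<and> {pathstart (gam e), pathfinish (gam e)} = pos ` e) \<and>
     (\<forall>e\<in>E. edge_interior gam e \<inter> pos ` V = {}) \<and>
     (\<forall>e1\<in>E. \<forall>e2\<in>E. \<forall>e3\<in>E. e1 \<noteq> e2 \<and> e1 \<noteq> e3 \<and> e2 \<noteq> e3 \<longrightarrow>
        edge_interior gam e1 \<inter> edge_interior gam e2 \<inter> edge_interior gam e3 = {}) \<and>
     (\<forall>e1\<in>E. \<forall>e2\<in>E. \<forall>c. e1 \<noteq> e2 \<and> c \<in> edge_interior gam e1 \<and> c \<in> edge_interior gam e2 \<longrightarrow>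
        crosses_transversally (path_image (gam e1)) (path_image (gam e2)) c)"

text \<open>k-plane drawing: each edge contains at most k crossing points, and two distinct
edge-curves share at most one point.\<close>
definition k_plane :: "nat \<Rightarrow> nat set \<Rightarrow> nat set set \<Rightarrow> (nat \<Rightarrow> complex) \<Rightarrow> (nat set \<Rightarrow> real \<Rightarrow> complex) \<Rightarrow> bool" where
  "k_plane k V E pos gam \<longleftrightarrow>
     drawing V E pos gam \<and>
     (\<forall>e\<in>E. finite (crossing_points E gam \<inter> edge_interior gam e) \<and>
            card (crossing_points E gam \<inter> edge_interior gam e) \<le> k) \<and>
     (\<forall>e1\<in>E. \<forall>e2\<in>E. e1 \<noteq> e2 \<longrightarrow>
        (\<forall>x y. x \<in> path_image (gam e1) \<inter> path_image (gam e2) \<and>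
               y \<in> path_image (gam e1) \<inter> path_image (gam e2) \<longrightarrow> x = y))"

text \<open>The point set of the drawing, the faces of the planarization (connected components of
its complement), and the vertices of the planarization (vertices and dummy crossing vertices).\<close>
definition drawing_set :: "nat set \<Rightarrow> nat set set \<Rightarrow> (nat \<Rightarrow> complex) \<Rightarrow> (nat set \<Rightarrow> real \<Rightarrow> complex) \<Rightarrow> complex set" where
  "drawing_set V E pos gam = pos ` V \<union> (\<Union>e\<in>E. path_image (gam e))"

definition faces :: "nat set \<Rightarrow> nat set set \<Rightarrow> (nat \<Rightarrow> complex) \<Rightarrow> (nat set \<Rightarrow> real \<Rightarrow> complex) \<Rightarrow> complex set set" where
  "faces V E pos gam = components (- drawing_set V E pos gam)"

definition planarization_vertices :: "nat set \<Rightarrow> nat set set \<Rightarrow> (nat \<Rightarrow> complex) \<Rightarrow> (nat set \<Rightarrow> real \<Rightarrow> complex) \<Rightarrow> complex set" where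
  "planarization_vertices V E pos gam = pos ` V \<union> crossing_points E gam"

text \<open>Two vertices of the planarization at distance 2 in the radial graph R(G), i.e. lying on the
boundary of a common face (joined through one face-vertex).\<close>
definition radial_step :: "nat set \<Rightarrow> nat set set \<Rightarrow> (nat \<Rightarrow> complex) \<Rightarrow> (nat set \<Rightarrow> real \<Rightarrow> complex) \<Rightarrow> (complex \<times> complex) set" where
  "radial_step V E pos gam =
     {(x, y). x \<in> planarization_vertices V E pos gam \<and> y \<in> planarization_vertices V E pos gam \<and>
        (\<exists>f\<in>faces V E pos gam. x \<in> frontier f \<and> y \<in> frontier f)}"

text \<open>Face distance: number of face-vertices on a shortest u-v path in R(G) (infinite if none).\<close>
definition face_dist :: "nat set \<Rightarrow> nat set set \<Rightarrow> (nat \<Rightarrow> complex) \<Rightarrow> (nat set \<Rightarrow> real \<Rightarrow> complex) \<Rightarrow> nat \<Rightarrow> nat \<Rightarrow> enat" where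
  "face_dist V E pos gam u v =
     (if \<exists>m. (pos u, pos v) \<in> radial_step V E pos gam ^^ m
      then enat (LEAST m. (pos u, pos v) \<in> radial_step V E pos gam ^^ m) else \<infinity>)"

text \<open>Vertex cuts.\<close>
definition adj_in :: "nat set \<Rightarrow> nat set set \<Rightarrow> (nat \<times> nat) set" where
  "adj_in W E = {(x, y). x \<in> W \<and> y \<in> W \<and> {x, y} \<in> E}"

definition vertex_cut :: "nat set \<Rightarrow> nat set set \<Rightarrow> nat set \<Rightarrow> bool" where
  "vertex_cut V E S \<longleftrightarrow> S \<subseteq> V \<and>
     (\<exists>a\<in>V - S. \<exists>b\<in>V - S. (a, b) \<notin> (adj_in (V - S) E)\<^sup>*)"

definition min_vertex_cut :: "nat set \<Rightarrow> nat set set \<Rightarrow> nat set \<Rightarrow> bool" where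
  "min_vertex_cut V E S \<longleftrightarrow> vertex_cut V E S \<and> (\<forall>T. vertex_cut V E T \<longrightarrow> card S \<le> card T)"

definition unique_min_vertex_cut :: "nat set \<Rightarrow> nat set set \<Rightarrow> nat set \<Rightarrow> bool" where
  "unique_min_vertex_cut V E S \<longleftrightarrow> min_vertex_cut V E S \<and> (\<forall>T. min_vertex_cut V E T \<longrightarrow> T = S)"

end

theory Submission
  imports Defs "HOL-Computational_Algebra.Polynomial"
begin

text \<open>
  Let \<open>n = p + 1\<close>. The graph consists of two ``ladders'' \<open>A\<close> and \<open>B\<close>, each the Cartesian product of
  \<open>K\<^sub>n\<close> with a path, so that a set of fewer than \<open>n\<close> vertices misses one of the \<open>n\<close> copies of the path,
  and this copy dominates its ladder: neither ladder can be disconnected by \<open>p\<close> vertices. Each of \<open>p\<close>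
  vertices of \<open>A\<close>, the sites, is joined to two private vertices of \<open>B\<close>; hence the set of sites is the only
  cut with at most \<open>p\<close> vertices.

  In the drawing \<open>A\<close> runs vertically and \<open>B\<close> runs to the right from the middle of \<open>A\<close>. The outermost
  copies of the path in \<open>A\<close> flare out with the distance from the middle, and level \<open>k\<close> above the middle is
  joined to level \<open>k\<close> below it by one long edge on either side. Together with two clique edges they bound
  a quadrilateral; these quadrilaterals are nested, and every face step crosses at most one of them. Only
  the right long edges are crossed by \<open>B\<close>, \<open>n \<le> 2 \<lfloor>\<surd>k\<rfloor>\<close> times each.

  Each clique is placed on an arc of a parabola, all opening in the same direction along the ladder, so
  that a matching edge meets clique edges at one of its ends only. An edge of a clique or of a matching is
  then crossed at most \<open>x y + 1\<close> times with \<open>x + y = n - 1\<close>. All edges are straight, and the vertices are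
  chosen on their arcs one after the other, avoiding finitely many lines, so that no three vertices are
  collinear and no three independent edges are concurrent.
\<close>

section \<open>Points in general position\<close>

text \<open>Twice the signed area of the triangle \<open>a b z\<close>: positive to the left of the
  line directed from \<open>a\<close> to \<open>b\<close>, zero on that line.\<close>

definition orient :: "complex \<Rightarrow> complex \<Rightarrow> complex \<Rightarrow> real" where
  "orient a b z = (Re b - Re a) * (Im z - Im a) - (Im b - Im a) * (Re z - Re a)"

lemma orient_cycle: "orient a b c = orient b c a"
  by (simp add: orient_def algebra_simps)

lemma orient_swap: "orient b a z = - orient a b z"
  by (simp add: orient_def algebra_simps)

lemma orient_self [simp]: "orient a b a = 0" "orient a b b = 0"
  by (simp_all add: orient_def algebra_simps)

lemma orient_affine:
  "orient a b ((1 - s) *\<^sub>R p + s *\<^sub>R q) = (1 - s) * orient a b p + s * orient a b q"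
  by (simp add: orient_def algebra_simps)

lemma orient_eq_0_iff:
  assumes "a \<noteq> b"
  shows "orient a b z = 0 \<longleftrightarrow> (\<exists>s. z = (1 - s) *\<^sub>R a + s *\<^sub>R b)"
proof
  assume 0: "orient a b z = 0"
  define u v where "u = Re b - Re a" and "v = Im b - Im a"
  have nz: "u\<^sup>2 + v\<^sup>2 \<noteq> 0"
    using assms by (auto simp: u_def v_def complex_eq_iff sum_power2_eq_zero_iff)
  \<comment> \<open>The parameter of the orthogonal projection of \<open>z\<close> onto the
    line.\<close>
  define s where "s = (u * (Re z - Re a) + v * (Im z - Im a)) / (u\<^sup>2 + v\<^sup>2)"
  have uv: "u * (Im z - Im a) = v * (Re z - Re a)"
    using 0 by (simp add: orient_def u_def v_def)
  have s: "s * (u\<^sup>2 + v\<^sup>2) = u * (Re z - Re a) + v * (Im z - Im a)"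
    using nz by (simp add: s_def)
  have "(u\<^sup>2 + v\<^sup>2) * (Re z - Re a) = u * (u * (Re z - Re a)) + v * (v * (Re z - Re a))"
    by (simp add: power2_eq_square algebra_simps)
  also have "\<dots> = u * (s * (u\<^sup>2 + v\<^sup>2))"
    unfolding s uv[symmetric] by (simp add: algebra_simps)
  finally have "(u\<^sup>2 + v\<^sup>2) * (Re z - Re a - s * u) = 0" by (simp add: algebra_simps)
  then have "Re z - Re a = s * u" using nz by (metis eq_iff_diff_eq_0 mult_eq_0_iff)
  moreover have "(u\<^sup>2 + v\<^sup>2) * (Im z - Im a - s * v) = 0"
    using s uv by algebra
  then have "Im z - Im a = s * v" using nz by (metis eq_iff_diff_eq_0 mult_eq_0_iff)
  ultimately have "z = (1 - s) *\<^sub>R a + s *\<^sub>R b"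
    by (simp add: complex_eq_iff u_def v_def algebra_simps)
  then show "\<exists>s. z = (1 - s) *\<^sub>R a + s *\<^sub>R b" by blast
next
  assume "\<exists>s. z = (1 - s) *\<^sub>R a + s *\<^sub>R b"
  then show "orient a b z = 0" by (auto simp: orient_affine)
qed

lemma orient_closed_segment: "z \<in> closed_segment a b \<Longrightarrow> orient a b z = 0"
  by (auto simp: in_segment orient_affine)

text \<open>Along the line \<open>c d\<close> the function \<open>orient a b\<close> is affine in
  the parameter, so two zeros make it vanish everywhere, in particular at \<open>c\<close>.\<close>

lemma orient_two_common_points:
  assumes "a \<noteq> b" "c \<noteq> d" "z \<noteq> z'" "orient a b z = 0" "orient a b z' = 0"
    and "orient c d z = 0" "orient c d z' = 0"
  shows "orient a b c = 0"
proof -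
  obtain u u' where u: "z = (1 - u) *\<^sub>R c + u *\<^sub>R d" "z' = (1 - u') *\<^sub>R c + u' *\<^sub>R d"
    using assms by (auto simp: orient_eq_0_iff)
  have "u \<noteq> u'" using u assms(3) by auto
  have "(1 - u) * orient a b c + u * orient a b d = 0" "(1 - u') * orient a b c + u' * orient a b d = 0"
    using assms(4,5) unfolding u by (simp_all add: orient_affine)
  then have "(u' - u) * orient a b c = 0" by algebra
  with \<open>u \<noteq> u'\<close> show ?thesis by simp
qed

text \<open>Concurrency is excluded for whole lines and not only for segments: a violation is then
  an algebraic condition on each point and can be avoided one point at a time.\<close>

definition generic :: "complex set \<Rightarrow> bool" where
  "generic X \<longleftrightarrow>
     (\<forall>a\<in>X. \<forall>b\<in>X. \<forall>c\<in>X. distinct [a, b, c] \<longrightarrow> orient a b c \<noteq> 0) \<and>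
     (\<forall>a\<in>X. \<forall>b\<in>X. \<forall>c\<in>X. \<forall>d\<in>X. \<forall>e\<in>X. \<forall>f\<in>X. distinct [a, b, c, d, e, f] \<longrightarrow>
        \<not> (\<exists>z. orient a b z = 0 \<and> orient c d z = 0 \<and> orient e f z = 0))"

lemma generic_triple:
  "generic X \<Longrightarrow> a \<in> X \<Longrightarrow> b \<in> X \<Longrightarrow> c \<in> X \<Longrightarrow> a \<noteq> b \<Longrightarrow> a \<noteq> c \<Longrightarrow> b \<noteq> c \<Longrightarrow> orient a b c \<noteq> 0"
  unfolding generic_def by simp

definition line_meets :: "complex set \<Rightarrow> complex set" where
  "line_meets X = {z. \<exists>a\<in>X. \<exists>b\<in>X. \<exists>c\<in>X. \<exists>d\<in>X. distinct [a, b, c, d] \<and> orient a b z = 0 \<and> orient c d z = 0}"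

text \<open>Two common points of the lines \<open>a b\<close> and \<open>c d\<close> would make
  \<open>a\<close>, \<open>b\<close>, \<open>c\<close> collinear, so each of the finitely many
  quadruples contributes at most one point.\<close>

lemma finite_line_meets:
  assumes "finite X" "generic X"
  shows "finite (line_meets X)"
proof -
  have "finite {z. distinct [a, b, c, d] \<and> orient a b z = 0 \<and> orient c d z = 0}"
    if "a \<in> X" "b \<in> X" "c \<in> X" "d \<in> X" for a b c d
  proof (cases "distinct [a, b, c, d]")
    case True
    have "z = z'" if "orient a b z = 0" "orient c d z = 0" "orient a b z' = 0" "orient c d z' = 0" for z z'
      using orient_two_common_points[of a b c d z z'] generic_triple[OF assms(2), of a b c]
        True that \<open>a \<in> X\<close> \<open>b \<in> X\<close> \<open>c \<in> X\<close> by auto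
    then have "\<exists>w. {z. distinct [a, b, c, d] \<and> orient a b z = 0 \<and> orient c d z = 0} \<subseteq> {w}"
      by blast
    then show ?thesis using finite_subset by blast
  qed auto
  then have "finite (\<Union>a\<in>X. \<Union>b\<in>X. \<Union>c\<in>X. \<Union>d\<in>X.
      {z. distinct [a, b, c, d] \<and> orient a b z = 0 \<and> orient c d z = 0})"
    using assms(1) by blast
  moreover have "line_meets X = (\<Union>a\<in>X. \<Union>b\<in>X. \<Union>c\<in>X. \<Union>d\<in>X.
      {z. distinct [a, b, c, d] \<and> orient a b z = 0 \<and> orient c d z = 0})"
    unfolding line_meets_def by blast
  ultimately show ?thesis by simp
qed

text \<open>If the new point \<open>x\<close> takes part in a concurrency, its line
  \<open>x u\<close> passes through a meeting point \<open>z\<close> of two old lines, and then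
  \<open>x\<close> lies on the line \<open>u z\<close>. It suffices to keep \<open>x\<close> off
  these lines and off the lines through two old points.\<close>

lemma generic_insert:
  assumes X: "generic X" "x \<notin> X"
    and 1: "\<And>a b. a \<in> X \<Longrightarrow> b \<in> X \<Longrightarrow> a \<noteq> b \<Longrightarrow> orient a b x \<noteq> 0"
    and 2: "\<And>u z. u \<in> X \<Longrightarrow> z \<in> line_meets X \<Longrightarrow> z \<noteq> u \<Longrightarrow> orient u z x \<noteq> 0"
  shows "generic (insert x X)"
proof -
  have T: "orient a b c \<noteq> 0" if "a \<in> insert x X" "b \<in> insert x X" "c \<in> insert x X" "distinct [a, b, c]" for a b c
  proof -
    have "a \<in> X \<and> b \<in> X \<or> b \<in> X \<and> c \<in> X \<or> c \<in> X \<and> a \<in> X" using that by auto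
    moreover have ?thesis if "c = x" "a \<in> X" "b \<in> X" "a \<noteq> b" using 1 that by blast
    moreover have ?thesis if "a = x" "b \<in> X" "c \<in> X" "b \<noteq> c"
      unfolding orient_cycle[of a b c] using 1 that by blast
    moreover have ?thesis if "b = x" "c \<in> X" "a \<in> X" "c \<noteq> a"
      unfolding orient_cycle[of a b c] orient_cycle[of b c a] using 1 that by blast
    moreover have ?thesis if "a \<in> X" "b \<in> X" "c \<in> X"
      using generic_triple[OF X(1) that] \<open>distinct [a, b, c]\<close> by simp
    ultimately show ?thesis using that by auto
  qed
  have key: False
    if "u \<in> X" "a \<in> X" "b \<in> X" "c \<in> X" "d \<in> X" "distinct [u, a, b, c, d]"
      and z: "orient x u z = 0" "orient a b z = 0" "orient c d z = 0" for u a b c d z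
  proof -
    have "z \<in> line_meets X" using that unfolding line_meets_def by auto
    \<comment> \<open>\<open>z = u\<close> would put \<open>u\<close> on the line
      \<open>a b\<close>, so \<open>u\<close> and \<open>z\<close> do span a line.\<close>
    moreover have "z \<noteq> u" using z(2) generic_triple[OF X(1), of a b u] that by auto
    ultimately have "orient u z x \<noteq> 0" using 2 \<open>u \<in> X\<close> by blast
    then show False using z(1) orient_cycle[of x u z] by simp
  qed
  have S: "\<not> (\<exists>z. orient a b z = 0 \<and> orient c d z = 0 \<and> orient e f z = 0)"
    if m: "a \<in> insert x X" "b \<in> insert x X" "c \<in> insert x X" "d \<in> insert x X" "e \<in> insert x X" "f \<in> insert x X"
      and dist: "distinct [a, b, c, d, e, f]" for a b c d e f
  proof
    assume "\<exists>z. orient a b z = 0 \<and> orient c d z = 0 \<and> orient e f z = 0"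
    then obtain z where z: "orient a b z = 0" "orient c d z = 0" "orient e f z = 0" by blast
    then have z': "orient b a z = 0" "orient d c z = 0" "orient f e z = 0"
      using orient_swap by (metis neg_equal_0_iff_equal)+
    consider "a = x" | "b = x" | "c = x" | "d = x" | "e = x" | "f = x"
      | "a \<in> X" "b \<in> X" "c \<in> X" "d \<in> X" "e \<in> X" "f \<in> X" using m by blast
    then show False
    proof cases
      case 1 then show ?thesis using key[of b c d e f z] m dist z by auto
    next
      case 2 then show ?thesis using key[of a c d e f z] m dist z z' by auto
    next
      case 3 then show ?thesis using key[of d a b e f z] m dist z by auto
    next
      case 4 then show ?thesis using key[of c a b e f z] m dist z z' by auto
    next
      case 5 then show ?thesis using key[of f a b c d z] m dist z by auto
    next
      case 6 then show ?thesis using key[of e a b c d z] m dist z z' by auto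
    next
      case 7 then show ?thesis using X(1) dist z unfolding generic_def by blast
    qed
  qed
  show ?thesis unfolding generic_def by (intro conjI ballI impI, erule (3) T, erule (6) S)
qed

text \<open>Greedy choice: the points placed so far forbid finitely many lines, each of which
  removes only finitely many candidates from an infinite set.\<close>

lemma generic_choice:
  assumes "finite W" and inf: "\<And>v. v \<in> W \<Longrightarrow> infinite (C v)"
    and fin: "\<And>v a b. v \<in> W \<Longrightarrow> a \<noteq> b \<Longrightarrow> finite {z \<in> C v. orient a b z = 0}"
  shows "\<exists>P. (\<forall>v\<in>W. P v \<in> C v) \<and> inj_on P W \<and> generic (P ` W)"
  using assms
proof (induction W rule: finite_induct)
  case empty
  then show ?case by (simp add: generic_def)
next
  case (insert v W)
  then obtain P where P: "\<forall>v\<in>W. P v \<in> C v" "inj_on P W" "generic (P ` W)"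
    by (metis insertCI)
  define X where "X = P ` W"
  have fX: "finite X" "generic X" using insert P by (auto simp: X_def)
  \<comment> \<open>The first part of the union keeps the placement injective, the second meets the
    two conditions of \<open>generic_insert\<close>.\<close>
  define bad where "bad = X \<union> (\<Union>a\<in>X. \<Union>b\<in>X \<union> line_meets X - {a}. {z \<in> C v. orient a b z = 0})"
  have "finite bad"
    unfolding bad_def using fX finite_line_meets[OF fX] insert.prems(2)[of v]
    by (intro finite_UnI finite_UN_I) auto
  then obtain x where x: "x \<in> C v" "x \<notin> bad"
    using insert.prems(1)[of v] by (meson finite_subset insertI1 subsetI)
  have g: "generic (insert x X)"
    by (rule generic_insert) (use x fX in \<open>auto simp: bad_def\<close>)
  have im: "(P(v := x)) ` insert v W = insert x X"
    using insert.hyps unfolding X_def by (auto simp: image_iff)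
  have "inj_on (P(v := x)) (insert v W)"
    using P(2) insert.hyps x unfolding bad_def X_def inj_on_def by auto
  moreover have "\<forall>w\<in>insert v W. (P(v := x)) w \<in> C w" using P(1) x(1) by auto
  ultimately show ?case using g im by metis
qed

section \<open>Intersections of parabolas with lines\<close>

lemma finite_quadratic_zeros:
  fixes c0 c1 c2 :: real
  assumes "c1 \<noteq> 0 \<or> c2 \<noteq> 0"
  shows "finite {t. c0 + c1 * t + c2 * t\<^sup>2 = 0}"
proof -
  have "[:c0, c1, c2:] \<noteq> 0" using assms by auto
  from poly_roots_finite[OF this] show ?thesis
    by (simp add: algebra_simps power2_eq_square)
qed

text \<open>Substituting the parametrisation into the equation of the line gives a polynomial whose
  linear and quadratic coefficients are, up to sign, the coordinates of \<open>b - a\<close>; they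
  do not both vanish.\<close>

lemma finite_parabola_Im_inter_line:
  assumes "a \<noteq> b"
  shows "finite {z \<in> (\<lambda>t. Complex t (c + t\<^sup>2)) ` I. orient a b z = 0}"
proof -
  define u v where "u = Re b - Re a" and "v = Im b - Im a"
  have "v \<noteq> 0 \<or> u \<noteq> 0" using assms by (auto simp: u_def v_def complex_eq_iff)
  then have "finite {t. (u * (c - Im a) + v * Re a) + (- v) * t + u * t\<^sup>2 = 0}"
    by (intro finite_quadratic_zeros) auto
  moreover have "{z \<in> (\<lambda>t. Complex t (c + t\<^sup>2)) ` I. orient a b z = 0}
      \<subseteq> (\<lambda>t. Complex t (c + t\<^sup>2)) ` {t. (u * (c - Im a) + v * Re a) + (- v) * t + u * t\<^sup>2 = 0}"
    by (auto simp: orient_def u_def v_def algebra_simps)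
  ultimately show ?thesis by (meson finite_imageI finite_subset)
qed

lemma finite_parabola_Re_inter_line:
  assumes "a \<noteq> b"
  shows "finite {z \<in> (\<lambda>t. Complex (c + t\<^sup>2) t) ` I. orient a b z = 0}"
proof -
  define u v where "u = Re b - Re a" and "v = Im b - Im a"
  have "u \<noteq> 0 \<or> - v \<noteq> 0" using assms by (auto simp: u_def v_def complex_eq_iff)
  then have "finite {t. (v * (Re a - c) - u * Im a) + u * t + (- v) * t\<^sup>2 = 0}"
    by (intro finite_quadratic_zeros) auto
  moreover have "{z \<in> (\<lambda>t. Complex (c + t\<^sup>2) t) ` I. orient a b z = 0}
      \<subseteq> (\<lambda>t. Complex (c + t\<^sup>2) t) ` {t. (v * (Re a - c) - u * Im a) + u * t + (- v) * t\<^sup>2 = 0}"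
    by (auto simp: orient_def u_def v_def algebra_simps)
  ultimately show ?thesis by (meson finite_imageI finite_subset)
qed

section \<open>Straight-line drawings\<close>

text \<open>The affine map \<open>g\<close> sends 0 to \<open>z\<close>, the real axis to the line
  \<open>a b\<close> and the imaginary axis to the line \<open>c d\<close>. Since the directions are
  independent it has an inverse, which is the required chart.\<close>

lemma crosses_transversally_segments:
  assumes z: "z \<in> open_segment a b" "z \<in> open_segment c d"
    and nz: "(Re b - Re a) * (Im d - Im c) - (Im b - Im a) * (Re d - Re c) \<noteq> 0"
  shows "crosses_transversally (closed_segment a b) (closed_segment c d) z"
proof -
  define D where "D = (Re b - Re a) * (Im d - Im c) - (Im b - Im a) * (Re d - Re c)"
  obtain s where s: "0 < s" "s < 1" "z = (1 - s) *\<^sub>R a + s *\<^sub>R b" using z(1) by (auto simp: in_segment)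
  obtain t where t: "0 < t" "t < 1" "z = (1 - t) *\<^sub>R c + t *\<^sub>R d" using z(2) by (auto simp: in_segment)
  \<comment> \<open>The margin of both parameters towards 0 and 1; with this scale \<open>g\<close>
    maps the two diameters of the unit disc into the segments.\<close>
  define \<rho> where "\<rho> = min (min s (1 - s)) (min t (1 - t))"
  have \<rho>: "0 < \<rho>" "\<rho> \<le> s" "\<rho> \<le> 1 - s" "\<rho> \<le> t" "\<rho> \<le> 1 - t" using s t by (auto simp: \<rho>_def)
  define g where "g = (\<lambda>w. z + (\<rho> * Re w) *\<^sub>R (b - a) + (\<rho> * Im w) *\<^sub>R (d - c))"
  \<comment> \<open>The inverse of \<open>g\<close> by Cramer's rule, with determinant
    \<open>D\<close>.\<close>
  define h where "h = (\<lambda>x. Complex (((Re x - Re z) * (Im d - Im c) - (Im x - Im z) * (Re d - Re c)) / (\<rho> * D))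
                              (((Re b - Re a) * (Im x - Im z) - (Im b - Im a) * (Re x - Re z)) / (\<rho> * D)))"
  have D: "\<rho> * D \<noteq> 0" using \<rho> nz by (simp add: D_def)
  have hg: "h (g w) = w" for w
  proof -
    have "(Re (g w) - Re z) * (Im d - Im c) - (Im (g w) - Im z) * (Re d - Re c) = \<rho> * D * Re w"
      "(Re b - Re a) * (Im (g w) - Im z) - (Im b - Im a) * (Re (g w) - Re z) = \<rho> * D * Im w"
      by (simp_all add: g_def D_def algebra_simps)
    then show ?thesis using D by (simp add: h_def complex_eq_iff)
  qed
  have gh: "g (h x) = x" for x
  proof -
    define X Y where "X = Re x - Re z" and "Y = Im x - Im z"
    define p q where "p = \<rho> * Re (h x)" and "q = \<rho> * Im (h x)"
    have p: "p = (X * (Im d - Im c) - Y * (Re d - Re c)) / D"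
      and q: "q = ((Re b - Re a) * Y - (Im b - Im a) * X) / D"
      using \<rho> by (simp_all add: p_def q_def h_def X_def Y_def)
    have "p * D = X * (Im d - Im c) - Y * (Re d - Re c)" "q * D = (Re b - Re a) * Y - (Im b - Im a) * X"
      using D by (simp_all add: p q)
    then have "D * (p * (Re b - Re a) + q * (Re d - Re c) - X) = 0"
      "D * (p * (Im b - Im a) + q * (Im d - Im c) - Y) = 0"
      unfolding D_def by algebra+
    then have "X = p * (Re b - Re a) + q * (Re d - Re c)" "Y = p * (Im b - Im a) + q * (Im d - Im c)"
      using D by auto
    then show ?thesis
      by (simp add: g_def complex_eq_iff p_def q_def X_def Y_def algebra_simps)
  qed
  define U where "U = h -` ball 0 1"
  have contg: "continuous_on S g" for S unfolding g_def by (intro continuous_intros)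
  have conth: "continuous_on S h" for S
    unfolding h_def Complex_eq using D by (intro continuous_intros) auto
  have "open U" unfolding U_def using conth[of UNIV] by (simp add: open_vimage)
  have gU: "g w \<in> U \<longleftrightarrow> w \<in> ball 0 1" for w by (simp add: U_def hg)
  have hz: "h z = 0" by (simp add: h_def complex_eq_iff)
  have hom: "homeomorphism U (ball 0 1) h g"
    unfolding homeomorphism_def
  proof (intro conjI ballI)
    show "h ` U = ball 0 1" by (auto simp: U_def image_iff) (metis hg)
    show "g ` ball 0 1 = U" by (auto simp: U_def image_iff hg) (metis gh mem_ball_0)
  qed (auto simp: hg gh contg conth)
  have A: "g w \<in> closed_segment a b \<longleftrightarrow> Im w = 0" if w: "w \<in> ball 0 1" for w
  proof
    assume "g w \<in> closed_segment a b"
    then have "orient a b (g w) = 0" by (rule orient_closed_segment)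
    moreover have "orient a b z = 0" using z(1) open_closed_segment orient_closed_segment by blast
    moreover have "orient a b (g w) = orient a b z + \<rho> * Im w * D"
      by (simp add: orient_def g_def D_def algebra_simps)
    ultimately show "Im w = 0" using D by auto
  next
    assume "Im w = 0"
    have "\<bar>Re w\<bar> < 1" using w abs_Re_le_cmod[of w] by simp
    then have "\<bar>\<rho> * Re w\<bar> \<le> \<rho>" using \<rho>(1) by (simp add: abs_mult)
    moreover have "g w = (1 - (s + \<rho> * Re w)) *\<^sub>R a + (s + \<rho> * Re w) *\<^sub>R b"
      using \<open>Im w = 0\<close> by (simp add: g_def s(3) algebra_simps)
    ultimately show "g w \<in> closed_segment a b" unfolding in_segment
      using \<rho> by (intro exI[of _ "s + \<rho> * Re w"]) auto
  qed
  have B: "g w \<in> closed_segment c d \<longleftrightarrow> Re w = 0" if w: "w \<in> ball 0 1" for w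
  proof
    assume "g w \<in> closed_segment c d"
    then have "orient c d (g w) = 0" by (rule orient_closed_segment)
    moreover have "orient c d z = 0" using z(2) open_closed_segment orient_closed_segment by blast
    moreover have "orient c d (g w) = orient c d z - \<rho> * Re w * D"
      by (simp add: orient_def g_def D_def algebra_simps)
    ultimately show "Re w = 0" using D by auto
  next
    assume "Re w = 0"
    have "\<bar>Im w\<bar> < 1" using w abs_Im_le_cmod[of w] by simp
    then have "\<bar>\<rho> * Im w\<bar> \<le> \<rho>" using \<rho>(1) by (simp add: abs_mult)
    moreover have "g w = (1 - (t + \<rho> * Im w)) *\<^sub>R c + (t + \<rho> * Im w) *\<^sub>R d"
      using \<open>Re w = 0\<close> by (simp add: g_def t(3) algebra_simps)
    ultimately show "g w \<in> closed_segment c d" unfolding in_segment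
      using \<rho> by (intro exI[of _ "t + \<rho> * Im w"]) auto
  qed
  have im: "h ` (U \<inter> S) = {w \<in> ball 0 1. g w \<in> S}" for S
  proof -
    have "w \<in> h ` (U \<inter> S)" if "w \<in> ball 0 1" "g w \<in> S" for w
      using that gU[of w] hg[of w] by (metis IntI imageI)
    then show ?thesis using U_def gh by auto
  qed
  have "h ` (U \<inter> closed_segment a b) = {z \<in> ball 0 1. Im z = 0}"
    "h ` (U \<inter> closed_segment c d) = {z \<in> ball 0 1. Re z = 0}"
    unfolding im using A B by blast+
  moreover have "z \<in> U" using hz by (simp add: U_def)
  ultimately show ?thesis
    unfolding crosses_transversally_def using \<open>open U\<close> hom hz by blast
qed

section \<open>The drawing axioms derived from general position\<close>

locale straight_drawing =
  fixes V :: "nat set" and E :: "nat set set" and pos :: "nat \<Rightarrow> complex"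
  assumes simple: "simple_graph V E" and inj: "inj_on pos V" and gen: "generic (pos ` V)"
begin

text \<open>An edge is an unordered pair; the order of the natural numbers picks a direction for its
  curve.\<close>

definition curve :: "nat set \<Rightarrow> real \<Rightarrow> complex" where
  "curve e = linepath (pos (Min e)) (pos (Max e))"

lemma edgeE:
  assumes "e \<in> E"
  obtains u v where "e = {u, v}" "u \<noteq> v" "u \<in> V" "v \<in> V" "pos u \<noteq> pos v" "curve e = linepath (pos u) (pos v)"
proof -
  obtain u v where uv: "u \<in> V" "v \<in> V" "u \<noteq> v" "e = {u, v}"
    using simple assms unfolding simple_graph_def by blast
  show ?thesis
  proof (cases "u < v")
    case True then show ?thesis using uv that[of u v] inj by (auto simp: curve_def inj_on_eq_iff)
  next
    case False then show ?thesis using uv that[of v u] inj by (auto simp: curve_def inj_on_eq_iff)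
  qed
qed

lemma linepath_image_open: "a \<noteq> b \<Longrightarrow> linepath a b ` {0<..<1} = open_segment a b" for a b :: complex
  unfolding linepath_def set_eq_iff in_segment image_iff Bex_def greaterThanLessThan_iff by blast

lemma edge_interior_open_segment:
  "a \<noteq> b \<Longrightarrow> curve e = linepath a b \<Longrightarrow> edge_interior curve e = open_segment a b"
  by (simp add: edge_interior_def linepath_image_open)

lemma path_image_curve: "e \<in> E \<Longrightarrow> path_image (curve e) = convex hull (pos ` e)"
  by (erule edgeE) (simp add: segment_convex_hull)

lemma pos_collinear:
  "u \<in> V \<Longrightarrow> v \<in> V \<Longrightarrow> w \<in> V \<Longrightarrow> u \<noteq> v \<Longrightarrow> orient (pos u) (pos v) (pos w) = 0 \<Longrightarrow> w = u \<or> w = v"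
  using generic_triple[OF gen, of "pos u" "pos v" "pos w"] inj by (auto simp: inj_on_eq_iff)

text \<open>Two common points put all four ends on one line, and general position then makes both
  pairs of ends equal.\<close>

lemma edges_share_one_point:
  assumes e: "e1 \<in> E" "e2 \<in> E" "e1 \<noteq> e2"
    and x: "x \<in> path_image (curve e1)" "x \<in> path_image (curve e2)"
    and y: "y \<in> path_image (curve e1)" "y \<in> path_image (curve e2)"
  shows "x = y"
proof (rule ccontr)
  assume "x \<noteq> y"
  obtain a b where ab: "e1 = {a, b}" "a \<noteq> b" "a \<in> V" "b \<in> V" "pos a \<noteq> pos b" "curve e1 = linepath (pos a) (pos b)"
    using edgeE[OF e(1)] .
  obtain c d where cd: "e2 = {c, d}" "c \<noteq> d" "c \<in> V" "d \<in> V" "pos c \<noteq> pos d" "curve e2 = linepath (pos c) (pos d)"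
    using edgeE[OF e(2)] .
  have o: "orient (pos a) (pos b) x = 0" "orient (pos a) (pos b) y = 0"
    "orient (pos c) (pos d) x = 0" "orient (pos c) (pos d) y = 0"
    using x y ab cd by (auto intro: orient_closed_segment)
  have "orient (pos a) (pos b) (pos c) = 0"
    using orient_two_common_points[OF _ _ \<open>x \<noteq> y\<close>] o ab cd by blast
  moreover have "orient (pos a) (pos b) (pos d) = 0"
    using orient_two_common_points[OF _ _ \<open>x \<noteq> y\<close>, of "pos a" "pos b" "pos d" "pos c"] o ab cd
    by (metis orient_swap neg_equal_0_iff_equal)
  ultimately have "c \<in> {a, b}" "d \<in> {a, b}" using pos_collinear ab cd by blast+
  then show False using ab cd e(3) by auto
qed

lemma interior_in_path_image: "edge_interior curve e \<subseteq> path_image (curve e)"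
  by (auto simp: edge_interior_def path_image_def)

lemma interior_no_vertex:
  assumes "e \<in> E" "w \<in> V" shows "pos w \<notin> edge_interior curve e"
proof
  assume w: "pos w \<in> edge_interior curve e"
  obtain u v where uv: "e = {u, v}" "u \<noteq> v" "u \<in> V" "v \<in> V" "pos u \<noteq> pos v" "curve e = linepath (pos u) (pos v)"
    using edgeE[OF assms(1)] .
  then have o: "pos w \<in> open_segment (pos u) (pos v)" using w by (simp add: edge_interior_open_segment)
  then have "orient (pos u) (pos v) (pos w) = 0" using open_closed_segment orient_closed_segment by blast
  then have "w = u \<or> w = v" using pos_collinear uv assms by blast
  then show False using o by (auto simp: open_segment_def)
qed

text \<open>Edges with a common end have no other common point, and a vertex is never interior to an
  edge.\<close>

lemma crossing_edges_disjoint: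
  assumes e: "e1 \<in> E" "e2 \<in> E" "e1 \<noteq> e2" and z: "z \<in> edge_interior curve e1" "z \<in> edge_interior curve e2"
  shows "e1 \<inter> e2 = {}"
proof (rule ccontr)
  assume "e1 \<inter> e2 \<noteq> {}"
  then obtain w where w: "w \<in> e1" "w \<in> e2" by blast
  have "pos w \<in> path_image (curve e)" if "e \<in> E" "w \<in> e" for e
    using that by (simp add: path_image_curve hull_inc)
  then have "z = pos w"
    using edges_share_one_point[OF e, of z "pos w"] z w e
      interior_in_path_image[of e1] interior_in_path_image[of e2] by blast
  moreover have "w \<in> V" using edgeE[OF e(1)] w(1) by blast
  ultimately show False using interior_no_vertex[OF e(1)] z(1) by blast
qed

lemma drawing_curve: "drawing V E pos curve"
  unfolding drawing_def
proof (intro conjI ballI impI allI)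
  show "simple_graph V E" "inj_on pos V" by (fact simple, fact inj)
next
  fix e assume "e \<in> E"
  then show "arc (curve e)" "{pathstart (curve e), pathfinish (curve e)} = pos ` e"
    by (auto elim!: edgeE)
next
  fix e assume "e \<in> E"
  then show "edge_interior curve e \<inter> pos ` V = {}" using interior_no_vertex by blast
next
  fix e1 e2 e3 assume e: "e1 \<in> E" "e2 \<in> E" "e3 \<in> E" "e1 \<noteq> e2 \<and> e1 \<noteq> e3 \<and> e2 \<noteq> e3"
  show "edge_interior curve e1 \<inter> edge_interior curve e2 \<inter> edge_interior curve e3 = {}"
  proof (rule ccontr)
    assume "edge_interior curve e1 \<inter> edge_interior curve e2 \<inter> edge_interior curve e3 \<noteq> {}"
    then obtain z where z: "z \<in> edge_interior curve e1" "z \<in> edge_interior curve e2" "z \<in> edge_interior curve e3"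
      by blast
    have disj: "e1 \<inter> e2 = {}" "e1 \<inter> e3 = {}" "e2 \<inter> e3 = {}"
      using e z crossing_edges_disjoint by blast+
    obtain a b where ab: "e1 = {a, b}" "a \<noteq> b" "a \<in> V" "b \<in> V" "pos a \<noteq> pos b" "curve e1 = linepath (pos a) (pos b)"
      using edgeE[OF e(1)] .
    obtain c d where cd: "e2 = {c, d}" "c \<noteq> d" "c \<in> V" "d \<in> V" "pos c \<noteq> pos d" "curve e2 = linepath (pos c) (pos d)"
      using edgeE[OF e(2)] .
    obtain f g where fg: "e3 = {f, g}" "f \<noteq> g" "f \<in> V" "g \<in> V" "pos f \<noteq> pos g" "curve e3 = linepath (pos f) (pos g)"
      using edgeE[OF e(3)] .
    \<comment> \<open>Three pairwise disjoint edges have six distinct ends, so the concurrency part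
      of \<open>generic\<close> applies.\<close>
    have "distinct [a, b, c, d, f, g]" using disj ab cd fg by auto
    then have "distinct [pos a, pos b, pos c, pos d, pos f, pos g]"
      using inj ab cd fg by (auto simp: inj_on_eq_iff)
    moreover have "orient (pos a) (pos b) z = 0" "orient (pos c) (pos d) z = 0" "orient (pos f) (pos g) z = 0"
      using z interior_in_path_image[of e1] interior_in_path_image[of e2] interior_in_path_image[of e3] ab cd fg
      by (auto intro!: orient_closed_segment)
    ultimately show False using gen ab cd fg unfolding generic_def by blast
  qed
next
  fix e1 e2 z assume e: "e1 \<in> E" "e2 \<in> E" "e1 \<noteq> e2 \<and> z \<in> edge_interior curve e1 \<and> z \<in> edge_interior curve e2"
  then have disj: "e1 \<inter> e2 = {}" using crossing_edges_disjoint by blast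
  obtain a b where ab: "e1 = {a, b}" "a \<noteq> b" "a \<in> V" "b \<in> V" "pos a \<noteq> pos b" "curve e1 = linepath (pos a) (pos b)"
    using edgeE[OF e(1)] .
  obtain c d where cd: "e2 = {c, d}" "c \<noteq> d" "c \<in> V" "d \<in> V" "pos c \<noteq> pos d" "curve e2 = linepath (pos c) (pos d)"
    using edgeE[OF e(2)] .
  have z: "z \<in> open_segment (pos a) (pos b)" "z \<in> open_segment (pos c) (pos d)"
    using e ab cd by (simp_all add: edge_interior_open_segment)
  \<comment> \<open>The determinant of the two directions. If it vanished,
    \<open>orient (pos a) (pos b)\<close> would be constant along the second segment; being zero at
    \<open>z\<close>, it would put \<open>c\<close> on the line through \<open>a\<close> and
    \<open>b\<close>.\<close>
  define D where "D = (Re (pos b) - Re (pos a)) * (Im (pos d) - Im (pos c)) - (Im (pos b) - Im (pos a)) * (Re (pos d) - Re (pos c))"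
  have "D \<noteq> 0"
  proof
    assume "D = 0"
    moreover have "orient (pos a) (pos b) (pos d) - orient (pos a) (pos b) (pos c) = D"
      by (simp add: orient_def D_def algebra_simps)
    moreover obtain t where "0 < t" "t < 1" "z = (1 - t) *\<^sub>R pos c + t *\<^sub>R pos d"
      using z(2) by (auto simp: in_segment)
    moreover have "orient (pos a) (pos b) z = 0" using z(1) open_closed_segment orient_closed_segment by blast
    ultimately have "(1 - t) * orient (pos a) (pos b) (pos c) + t * orient (pos a) (pos b) (pos c) = 0"
      by (metis orient_affine eq_iff_diff_eq_0)
    then have "orient (pos a) (pos b) (pos c) = 0" by (simp add: algebra_simps)
    then have "c \<in> {a, b}" using pos_collinear ab cd by blast
    then show False using disj ab cd by auto
  qed
  then show "crosses_transversally (path_image (curve e1)) (path_image (curve e2)) z"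
    using crosses_transversally_segments[OF z] ab cd by (simp add: D_def)
qed

text \<open>Each crossing on \<open>e\<close> is the only common point of \<open>e\<close> with some
  disjoint edge, so counting such edges bounds the crossings. Convex hulls make the count
  independent of the direction of the curves.\<close>

lemma k_plane_curve:
  assumes count: "\<And>e. e \<in> E \<Longrightarrow>
    card {e' \<in> E. e \<inter> e' = {} \<and> convex hull (pos ` e) \<inter> convex hull (pos ` e') \<noteq> {}} \<le> k"
  shows "k_plane k V E pos curve"
  unfolding k_plane_def
proof (intro conjI ballI impI allI)
  show "drawing V E pos curve" by (rule drawing_curve)
next
  fix e1 e2 x y assume "e1 \<in> E" "e2 \<in> E" "e1 \<noteq> e2"
    "x \<in> path_image (curve e1) \<inter> path_image (curve e2) \<and> y \<in> path_image (curve e1) \<inter> path_image (curve e2)"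
  then show "x = y" using edges_share_one_point by blast
next
  fix e assume e: "e \<in> E"
  define X where "X = {e' \<in> E. e \<inter> e' = {} \<and> convex hull (pos ` e) \<inter> convex hull (pos ` e') \<noteq> {}}"
  define pt where "pt e' = (SOME z. z \<in> path_image (curve e) \<inter> path_image (curve e'))" for e'
  have "E \<subseteq> Pow V" using simple by (auto simp: simple_graph_def)
  then have "finite E" using simple finite_subset unfolding simple_graph_def by blast
  then have "finite X" by (simp add: X_def)
  have "crossing_points E curve \<inter> edge_interior curve e \<subseteq> pt ` X"
  proof
    fix z assume z: "z \<in> crossing_points E curve \<inter> edge_interior curve e"
    then obtain e' where e': "e' \<in> E" "e' \<noteq> e" "z \<in> edge_interior curve e'"
      by (auto simp: crossing_points_def)
    have zz: "z \<in> path_image (curve e) \<inter> path_image (curve e')"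
      using z e' interior_in_path_image by blast
    then have "pt e' \<in> path_image (curve e) \<inter> path_image (curve e')"
      unfolding pt_def by (rule someI)
    then have "z = pt e'" using zz edges_share_one_point e e' by blast
    moreover have "e' \<in> X"
      using crossing_edges_disjoint[of e e' z] e e' z zz by (auto simp: X_def path_image_curve)
    ultimately show "z \<in> pt ` X" by blast
  qed
  with \<open>finite X\<close> show "finite (crossing_points E curve \<inter> edge_interior curve e)"
    using finite_subset by blast
  have "card (crossing_points E curve \<inter> edge_interior curve e) \<le> card X"
    using surj_card_le[OF \<open>finite X\<close>] \<open>crossing_points E curve \<inter> edge_interior curve e \<subseteq> pt ` X\<close> by blast
  then show "card (crossing_points E curve \<inter> edge_interior curve e) \<le> k"
    using count[OF e] by (simp add: X_def)
qed

end

section \<open>Nested quadrilaterals and face distance\<close>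

text \<open>Every three consecutive corners make a left turn: the corners are listed
  counterclockwise.\<close>

definition convex_quad :: "complex \<Rightarrow> complex \<Rightarrow> complex \<Rightarrow> complex \<Rightarrow> bool" where
  "convex_quad a b c d \<longleftrightarrow> 0 < orient a b c \<and> 0 < orient b c d \<and> 0 < orient c d a \<and> 0 < orient d a b"

definition quad_interior :: "complex \<Rightarrow> complex \<Rightarrow> complex \<Rightarrow> complex \<Rightarrow> complex set" where
  "quad_interior a b c d = {z. 0 < orient a b z \<and> 0 < orient b c z \<and> 0 < orient c d z \<and> 0 < orient d a z}"

lemma continuous_orient [continuous_intros]: "continuous_on S (orient a b)"
  unfolding orient_def by (intro continuous_intros)

lemma convex_orient_ge: "convex {z. 0 \<le> orient a b z}" and convex_orient_gt: "convex {z. 0 < orient a b z}"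
proof -
  have "orient a b (u *\<^sub>R x + v *\<^sub>R y) = u * orient a b x + v * orient a b y" if "u + v = 1" for u v x y
    using orient_affine[of a b v x y] that by (metis add_diff_cancel_right')
  then show "convex {z. 0 \<le> orient a b z}" "convex {z. 0 < orient a b z}"
    unfolding convex_def by (auto, smt (verit) mult_nonneg_nonneg mult_pos_pos)
qed

text \<open>Expanded about \<open>z\<close>, the determinant is a sum of two products of positive
  differences.\<close>

lemma orient_right_of:
  assumes "Re z < Re b" "Re z < Re c" "Im b < Im z" "Im z < Im c"
  shows "0 < orient b c z"
proof -
  have "orient b c z = (Re c - Re z) * (Im z - Im b) + (Re b - Re z) * (Im c - Im z)"
    by (simp add: orient_def algebra_simps)
  then show ?thesis using assms by (simp add: add_pos_pos)
qed

lemma orient_left_of: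
  assumes "Re d < Re z" "Re a < Re z" "Im a < Im z" "Im z < Im d"
  shows "0 < orient d a z"
proof -
  have "orient d a z = (Re z - Re a) * (Im d - Im z) + (Re z - Re d) * (Im z - Im a)"
    by (simp add: orient_def algebra_simps)
  then show ?thesis using assms by (simp add: add_pos_pos)
qed

text \<open>The three orientation values divided by their sum are the barycentric coordinates of
  \<open>z\<close>.\<close>

lemma in_triangle:
  assumes "0 < orient a b c" "0 \<le> orient a b z" "0 \<le> orient b c z" "0 \<le> orient c a z"
  shows "z \<in> convex hull {a, b, c}"
proof -
  define D u v w where "D = orient a b c" and "u = orient b c z / D" and "v = orient c a z / D" and "w = orient a b z / D"
  have D: "D > 0" using assms by (simp add: D_def)
  have sum: "orient b c z + orient c a z + orient a b z = D"
    by (simp add: D_def orient_def algebra_simps)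
  then have 1: "u + v + w = 1" using D by (simp add: u_def v_def w_def add_divide_distrib[symmetric])
  have "D * Re z = orient b c z * Re a + orient c a z * Re b + orient a b z * Re c"
    "D * Im z = orient b c z * Im a + orient c a z * Im b + orient a b z * Im c"
    by (simp_all add: D_def orient_def algebra_simps)
  then have "z = u *\<^sub>R a + v *\<^sub>R b + w *\<^sub>R c"
    using D by (simp add: u_def v_def w_def complex_eq_iff field_simps)
  moreover have "0 \<le> u" "0 \<le> v" "0 \<le> w" using assms D by (simp_all add: u_def v_def w_def)
  ultimately show ?thesis using 1 by (auto simp: convex_hull_3)
qed

lemma quad_interior_subset_hull:
  assumes "convex_quad a b c d"
  shows "quad_interior a b c d \<subseteq> convex hull {a, b, c, d}"
proof
  fix z assume z: "z \<in> quad_interior a b c d"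
  show "z \<in> convex hull {a, b, c, d}"
  \<comment> \<open>The diagonal through \<open>a\<close> and \<open>c\<close> splits the
    quadrilateral into two triangles.\<close>
  proof (cases "0 \<le> orient c a z")
    case True
    then have "z \<in> convex hull {a, b, c}"
      using z assms by (intro in_triangle) (auto simp: convex_quad_def quad_interior_def)
    then show ?thesis using hull_mono[of "{a, b, c}" "{a, b, c, d}"] by auto
  next
    case False
    then have "0 \<le> orient a c z" by (metis neg_0_le_iff_le orient_swap linear)
    moreover have "0 < orient a c d" using assms orient_cycle unfolding convex_quad_def by metis
    ultimately have "z \<in> convex hull {a, c, d}"
      using z by (intro in_triangle) (auto simp: quad_interior_def)
    then show ?thesis using hull_mono[of "{a, c, d}" "{a, b, c, d}"] by auto
  qed
qed

text \<open>The half-planes at the two adjacent sides cut the line \<open>a b\<close> down to the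
  side: one bounds the parameter by 1, the other by 0.\<close>

lemma orient_zero_in_side:
  assumes "0 < orient b c a" "0 < orient d a b" "orient a b z = 0" "0 \<le> orient b c z" "0 \<le> orient d a z"
  shows "z \<in> closed_segment a b"
proof -
  have "a \<noteq> b" using assms by auto
  then obtain s where s: "z = (1 - s) *\<^sub>R a + s *\<^sub>R b" using assms orient_eq_0_iff by blast
  have "0 \<le> 1 - s" using assms(1,4) unfolding s by (simp add: orient_affine zero_le_mult_iff)
  moreover have "0 \<le> s" using assms(2,5) unfolding s by (simp add: orient_affine zero_le_mult_iff)
  ultimately show ?thesis using s by (auto simp: in_segment)
qed

text \<open>The open interior and the complement of the closed quadrilateral are disjoint open sets
  that cover everything but the sides, so a connected set avoiding the sides lies in one of
  them.\<close>

lemma connected_avoiding_quad: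
  assumes q: "convex_quad a b c d" and f: "connected f"
    and dis: "f \<inter> (closed_segment a b \<union> closed_segment b c \<union> closed_segment c d \<union> closed_segment d a) = {}"
  shows "f \<subseteq> quad_interior a b c d \<or> f \<inter> convex hull {a, b, c, d} = {}"
proof -
  define C where "C = {z. 0 \<le> orient a b z} \<inter> {z. 0 \<le> orient b c z} \<inter> {z. 0 \<le> orient c d z} \<inter> {z. 0 \<le> orient d a z}"
  have "closed C" unfolding C_def
    by (intro closed_Int closed_Collect_le continuous_intros)
  have qi: "quad_interior a b c d = {z. 0 < orient a b z} \<inter> {z. 0 < orient b c z} \<inter> {z. 0 < orient c d z} \<inter> {z. 0 < orient d a z}"
    by (auto simp: quad_interior_def)
  have "open (quad_interior a b c d)" unfolding qi
    by (intro open_Int open_Collect_less continuous_intros)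
  have pos: "0 < orient a b c" "0 < orient b c d" "0 < orient c d a" "0 < orient d a b"
    "0 < orient b c a" "0 < orient c d b" "0 < orient d a c" "0 < orient a b d"
    using q unfolding convex_quad_def by (metis orient_cycle)+
  have "convex C" unfolding C_def by (intro convex_Int convex_orient_ge)
  moreover have "{a, b, c, d} \<subseteq> C" using pos by (auto simp: C_def)
  ultimately have hull: "convex hull {a, b, c, d} \<subseteq> C" by (rule hull_minimal[rotated])
  have "C \<subseteq> quad_interior a b c d \<union> (closed_segment a b \<union> closed_segment b c \<union> closed_segment c d \<union> closed_segment d a)"
  proof
    fix z assume "z \<in> C"
    then have z: "0 \<le> orient a b z" "0 \<le> orient b c z" "0 \<le> orient c d z" "0 \<le> orient d a z" by (auto simp: C_def)
    consider "orient a b z = 0" | "orient b c z = 0" | "orient c d z = 0" | "orient d a z = 0" | "z \<in> quad_interior a b c d"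
      using z by (force simp: quad_interior_def)
    then show "z \<in> quad_interior a b c d \<union> (closed_segment a b \<union> closed_segment b c \<union> closed_segment c d \<union> closed_segment d a)"
      by cases (use orient_zero_in_side[of b c a d z] orient_zero_in_side[of c d b a z]
          orient_zero_in_side[of d a c b z] orient_zero_in_side[of a b d c z] pos z in auto)
  qed
  then have sub: "f \<subseteq> quad_interior a b c d \<union> - C" using dis by blast
  have "quad_interior a b c d \<subseteq> C" by (auto simp: qi C_def)
  then have "quad_interior a b c d \<inter> (- C) \<inter> f = {}" by blast
  then have "quad_interior a b c d \<inter> f = {} \<or> - C \<inter> f = {}"
    using connectedD[OF f \<open>open (quad_interior a b c d)\<close>, of "- C"] \<open>closed C\<close> sub by blast
  then show ?thesis using sub hull by blast
qed

text \<open>A face with the inner point \<open>x\<close> on its frontier meets the open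
  quadrilateral. As it avoids the sides it lies inside, and its whole frontier stays in the closed
  hull.\<close>

lemma radial_step_quad:
  assumes q: "convex_quad a b c d"
    and sides: "closed_segment a b \<union> closed_segment b c \<union> closed_segment c d \<union> closed_segment d a \<subseteq> drawing_set V E pos gam"
    and x: "x \<in> quad_interior a b c d" and xy: "(x, y) \<in> radial_step V E pos gam"
  shows "y \<in> convex hull {a, b, c, d}"
proof -
  obtain f where f: "f \<in> components (- drawing_set V E pos gam)" "x \<in> frontier f" "y \<in> frontier f"
    using xy by (auto simp: radial_step_def faces_def)
  have "connected f" "f \<subseteq> - drawing_set V E pos gam"
    using f in_components_connected in_components_subset by blast+
  then have "f \<subseteq> quad_interior a b c d \<or> f \<inter> convex hull {a, b, c, d} = {}"
    using connected_avoiding_quad[OF q, of f] sides by blast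
  then show ?thesis
  proof
    assume "f \<subseteq> quad_interior a b c d"
    then have "f \<subseteq> convex hull {a, b, c, d}" using quad_interior_subset_hull[OF q] by blast
    moreover have "closed (convex hull {a, b, c, d})"
      by (intro compact_imp_closed finite_imp_compact_convex_hull) simp
    ultimately show ?thesis using f(3) closure_minimal[of f] by (auto simp: frontier_def)
  next
    assume dis: "f \<inter> convex hull {a, b, c, d} = {}"
    have "quad_interior a b c d = {z. 0 < orient a b z} \<inter> {z. 0 < orient b c z} \<inter> {z. 0 < orient c d z} \<inter> {z. 0 < orient d a z}"
      by (auto simp: quad_interior_def)
    then have "open (quad_interior a b c d)"
      by (auto intro!: open_Int open_Collect_less continuous_intros)
    moreover have "x \<in> closure f" using f(2) by (simp add: frontier_def)
    ultimately have "quad_interior a b c d \<inter> f \<noteq> {}"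
      using x open_Int_closure_eq_empty by blast
    then show ?thesis using dis quad_interior_subset_hull[OF q] by blast
  qed
qed

text \<open>Each closed quadrilateral lies in the interior of the next one, so \<open>m\<close>
  steps from \<open>c i\<close> end in the closed quadrilateral \<open>i + m\<close>. The corner
  \<open>c j\<close> is not interior to quadrilateral \<open>j\<close>, hence not in quadrilateral
  \<open>j - 1\<close>, and \<open>j - i\<close> steps are needed.\<close>

lemma face_dist_nested_quads:
  fixes a b c d :: "nat \<Rightarrow> complex"
  assumes q: "\<And>k. k \<in> {1..K} \<Longrightarrow> convex_quad (a k) (b k) (c k) (d k)"
    and sides: "\<And>k. k \<in> {1..K} \<Longrightarrow> closed_segment (a k) (b k) \<union> closed_segment (b k) (c k) \<union>
        closed_segment (c k) (d k) \<union> closed_segment (d k) (a k) \<subseteq> drawing_set V E pos gam"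
    and nest: "\<And>k. 1 \<le> k \<Longrightarrow> k < K \<Longrightarrow>
        {a k, b k, c k, d k} \<subseteq> quad_interior (a (Suc k)) (b (Suc k)) (c (Suc k)) (d (Suc k))"
    and i: "1 \<le> i" "i < j" "j \<le> K" "pos u = c i" "pos v = c j"
  shows "enat (j - i) \<le> face_dist V E pos gam u v" "enat (j - i) \<le> face_dist V E pos gam v u"
proof -
  let ?R = "radial_step V E pos gam"
  define D where "D k = convex hull {a k, b k, c k, d k}" for k
  define O' where "O' k = quad_interior (a k) (b k) (c k) (d k)" for k
  have DO: "D k \<subseteq> O' (Suc k)" if "1 \<le> k" "k < K" for k
  proof -
    have "convex (O' (Suc k))"
      unfolding O'_def quad_interior_def Collect_conj_eq by (intro convex_Int convex_orient_gt)
    then show ?thesis unfolding D_def using nest[OF that] hull_minimal unfolding O'_def by metis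
  qed
  have OD: "O' k \<subseteq> D k" if "k \<in> {1..K}" for k
    unfolding O'_def D_def by (rule quad_interior_subset_hull[OF q[OF that]])
  have mono: "D k \<subseteq> D k'" if "k \<le> k'" "1 \<le> k" "k' \<le> K" for k k'
    using that
  proof (induction k' rule: dec_induct)
    case (step m)
    then show ?case using DO[of m] OD[of "Suc m"] by auto
  qed simp
  have step: "y \<in> D (Suc k)" if "1 \<le> k" "k < K" "x \<in> D k" "(x, y) \<in> ?R" for k x y
    using radial_step_quad[OF q[of "Suc k"] sides[of "Suc k"], of x y] DO[of k] that unfolding D_def O'_def by auto
  have steps: "i + m \<le> K \<Longrightarrow> (pos u, y) \<in> ?R ^^ m \<Longrightarrow> y \<in> D (i + m)" for m y
  proof (induction m arbitrary: y)
    case 0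
    then show ?case using i by (auto simp: D_def hull_inc)
  next
    case (Suc m)
    then obtain x where "(pos u, x) \<in> ?R ^^ m" "(x, y) \<in> ?R" by auto
    then show ?case using Suc step[of "i + m" x y] i by auto
  qed
  \<comment> \<open>A corner lies on the lines of its own sides, so a strict inequality
    fails.\<close>
  have "pos v \<notin> O' j" using i by (simp add: O'_def quad_interior_def)
  moreover have "1 \<le> j - 1" "j - 1 < K" "Suc (j - 1) = j" using i by linarith+
  ultimately have v: "pos v \<notin> D (j - 1)" using DO[of "j - 1"] by auto
  have far: "j - i \<le> m" if "(pos u, pos v) \<in> ?R ^^ m" for m
  proof (rule ccontr)
    assume "\<not> j - i \<le> m"
    then have "pos v \<in> D (i + m)" "D (i + m) \<subseteq> D (j - 1)"
      using steps[of m "pos v"] mono[of "i + m" "j - 1"] that i by auto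
    then show False using v by blast
  qed
  have R: "(y, x) \<in> ?R" if "(x, y) \<in> ?R" for x y
    using that by (auto simp: radial_step_def)
  have "(y, x) \<in> ?R ^^ m" if "(x, y) \<in> ?R ^^ m" for x y m
    using that
  proof (induction m arbitrary: y)
    case (Suc m)
    then obtain w where "(x, w) \<in> ?R ^^ m" "(w, y) \<in> ?R" by auto
    then show ?case using Suc.IH R relpow_Suc_I2 by metis
  qed simp
  then have sym: "(x, y) \<in> ?R ^^ m \<longleftrightarrow> (y, x) \<in> ?R ^^ m" for x y m by blast
  \<comment> \<open>If no radial path exists, the distance is infinite and the bound is
    trivial.\<close>
  show 1: "enat (j - i) \<le> face_dist V E pos gam u v"
    unfolding face_dist_def using far LeastI_ex[of "\<lambda>m. (pos u, pos v) \<in> ?R ^^ m"] by auto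
  show "enat (j - i) \<le> face_dist V E pos gam v u"
    using 1 unfolding face_dist_def sym[of "pos v" "pos u"] .
qed

section \<open>The graph and its vertex cuts\<close>

text \<open>The first argument is the level and the second the row. Levels of \<open>A\<close> are
  integers, so that level \<open>k\<close> can be paired with level \<open>- 1 - k\<close>; the
  middle of \<open>A\<close> lies between levels -1 and 0.\<close>

datatype vtx = A int nat | B nat nat

instance vtx :: countable
  by countable_datatype

text \<open>Edges are named by kind and indices, which turns the study of crossings into a case
  distinction.\<close>

datatype lab = CliqueA int nat nat | MatchA int nat | Loop nat nat
  | CliqueB nat nat nat | MatchB nat nat | Link nat nat

text \<open>The site of level \<open>k\<close> will be joined to levels \<open>k\<close> and
  \<open>k - 1\<close> of \<open>B\<close>; the spacing makes these neighbours private to the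
  site.\<close>

locale ladders =
  fixes n K :: nat and sites :: "nat set"
  assumes n2: "2 \<le> n"
    and sites_sub: "sites \<subseteq> {1..K}"
    and sites_spaced: "k \<in> sites \<Longrightarrow> Suc k \<notin> sites"
    and card_sites: "card sites = n - 1"
begin

fun src :: "lab \<Rightarrow> vtx" where
  "src (CliqueA j a b) = A j a"
| "src (MatchA j i) = A j i"
| "src (Loop k i) = A (int k) i"
| "src (CliqueB m a b) = B m a"
| "src (MatchB m i) = B m i"
| "src (Link k m) = A (int k) (n - 1)"

fun dst :: "lab \<Rightarrow> vtx" where
  "dst (CliqueA j a b) = A j b"
| "dst (MatchA j i) = A (j + 1) i"
| "dst (Loop k i) = A (- 1 - int k) i"
| "dst (CliqueB m a b) = B m b"
| "dst (MatchB m i) = B (Suc m) i"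
| "dst (Link k m) = B m (n - 1)"

text \<open>
  A loop is crossed by all \<open>n\<close> rows of \<open>B\<close>. For \<open>n = 2\<close> this may exceed \<open>k = 1\<close>, but then there is only
  one site and no loop is needed.
\<close>

fun valid :: "lab \<Rightarrow> bool" where
  "valid (CliqueA j a b) \<longleftrightarrow> - int K - 1 \<le> j \<and> j \<le> int K \<and> a < b \<and> b < n"
| "valid (MatchA j i) \<longleftrightarrow> - int K - 1 \<le> j \<and> j < int K \<and> i < n"
| "valid (Loop k i) \<longleftrightarrow> 3 \<le> n \<and> 1 \<le> k \<and> k \<le> K \<and> (i = 0 \<or> i = n - 1)"
| "valid (CliqueB m a b) \<longleftrightarrow> m \<le> K \<and> a < b \<and> b < n"
| "valid (MatchB m i) \<longleftrightarrow> m < K \<and> i < n"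
| "valid (Link k m) \<longleftrightarrow> k \<in> sites \<and> (m = k \<or> Suc m = k)"

definition verts :: "vtx set" where
  "verts = (\<lambda>(j, i). A j i) ` ({- int K - 1..int K} \<times> {..<n}) \<union> (\<lambda>(m, i). B m i) ` ({..K} \<times> {..<n})"

lemma finite_verts: "finite verts"
  by (simp add: verts_def)

lemma A_in_verts [simp]: "A j i \<in> verts \<longleftrightarrow> - int K - 1 \<le> j \<and> j \<le> int K \<and> i < n"
  and B_in_verts [simp]: "B m i \<in> verts \<longleftrightarrow> m \<le> K \<and> i < n"
  by (auto simp: verts_def)

lemma site_bounds: "k \<in> sites \<Longrightarrow> 1 \<le> k \<and> k \<le> K"
  using sites_sub by auto

lemma valid_ends: "valid l \<Longrightarrow> src l \<in> verts \<and> dst l \<in> verts \<and> src l \<noteq> dst l"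
  using n2 site_bounds by (cases l) force+

definition V :: "nat set" where "V = to_nat ` verts"

definition edge :: "lab \<Rightarrow> nat set" where "edge l = {to_nat (src l), to_nat (dst l)}"

definition E :: "nat set set" where "E = edge ` {l. valid l}"

definition S :: "nat set" where "S = (\<lambda>k. to_nat (A (int k) (n - 1))) ` sites"

lemma simple_graph: "simple_graph V E"
  unfolding simple_graph_def
proof (intro conjI ballI)
  show "finite V" by (simp add: V_def finite_verts)
  fix e assume "e \<in> E"
  then obtain l where "valid l" "e = {to_nat (src l), to_nat (dst l)}" by (auto simp: E_def edge_def)
  then show "\<exists>u v. u \<in> V \<and> v \<in> V \<and> u \<noteq> v \<and> e = {u, v}"
    using valid_ends[of l] by (auto simp: V_def)
qed

lemma card_S: "card S = n - 1"
  unfolding S_def using card_sites by (subst card_image) (auto simp: inj_on_def)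

section \<open>Connectivity after the removal of few vertices\<close>

abbreviation linked :: "nat set \<Rightarrow> vtx \<Rightarrow> vtx \<Rightarrow> bool" where
  "linked T u v \<equiv> (to_nat u, to_nat v) \<in> (adj_in (V - T) E)\<^sup>*"

lemma linked_sym: "linked T u v \<Longrightarrow> linked T v u"
proof -
  have "sym (adj_in (V - T) E)" by (auto simp: sym_def adj_in_def insert_commute)
  then show "linked T u v \<Longrightarrow> linked T v u" by (meson sym_rtrancl symD)
qed

lemma linked_trans: "linked T u v \<Longrightarrow> linked T v w \<Longrightarrow> linked T u w"
  by (rule rtrancl_trans)

lemma linked_edge:
  assumes "valid l" "to_nat (src l) \<notin> T" "to_nat (dst l) \<notin> T"
  shows "linked T (src l) (dst l)"
proof -
  have "(to_nat (src l), to_nat (dst l)) \<in> adj_in (V - T) E"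
    using assms valid_ends[of l] by (auto simp: adj_in_def E_def edge_def V_def)
  then show ?thesis by blast
qed

lemma free_row:
  fixes f :: "'a \<Rightarrow> nat \<Rightarrow> vtx"
  assumes T: "finite T" "card T < n" and f: "\<And>j i j' i'. f j i = f j' i' \<Longrightarrow> i = i'"
  shows "\<exists>i<n. \<forall>j. to_nat (f j i) \<notin> T"
proof (rule ccontr)
  assume "\<not> ?thesis"
  then have "\<forall>i\<in>{..<n}. \<exists>j. to_nat (f j i) \<in> T" by auto
  \<comment> \<open>One vertex of \<open>T\<close> from each row; rows are disjoint, so these are
    \<open>n\<close> distinct vertices.\<close>
  then obtain g where g: "\<forall>i\<in>{..<n}. to_nat (f (g i) i) \<in> T" by metis
  have "inj_on (\<lambda>i. to_nat (f (g i) i)) {..<n}" using f by (auto simp: inj_on_def)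
  then have "card {..<n} \<le> card T" using g T(1) by (intro card_inj_on_le) auto
  then show False using T by simp
qed

lemma linked_row_A:
  assumes i: "i < n" "\<forall>j. to_nat (A j i) \<notin> T" and j: "- int K - 1 \<le> j" "j \<le> int K"
  shows "linked T (A j i) (A 0 i)"
proof -
  have up: "linked T (A (int k) i) (A 0 i)" if "k \<le> K" for k
    using that
  proof (induction k)
    case (Suc k)
    have "linked T (A (int k) i) (A (int k + 1) i)"
      using linked_edge[of "MatchA (int k) i" T] i Suc.prems by simp
    then have "linked T (A (int k + 1) i) (A 0 i)" using Suc linked_sym linked_trans by (meson Suc_leD)
    then show ?case by (simp add: add.commute)
  qed simp
  have down: "linked T (A (- int k) i) (A 0 i)" if "k \<le> K + 1" for k
    using that
  proof (induction k)
    case (Suc k)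
    have "linked T (A (- int (Suc k)) i) (A (- int k) i)"
      using linked_edge[of "MatchA (- int (Suc k)) i" T] i Suc.prems by simp
    then show ?case using Suc linked_trans by (meson Suc_leD)
  qed simp
  show ?thesis using up[of "nat j"] down[of "nat (- j)"] j by (cases "0 \<le> j") auto
qed

lemma linked_row_B:
  assumes i: "i < n" "\<forall>m. to_nat (B m i) \<notin> T" and "m \<le> K"
  shows "linked T (B m i) (B 0 i)"
  using assms(3)
proof (induction m)
  case (Suc m)
  have "linked T (B m i) (B (Suc m) i)"
    using linked_edge[of "MatchB m i" T] i Suc.prems by simp
  then show ?case using Suc linked_sym linked_trans by (meson Suc_leD)
qed simp

lemma linked_to_row_A:
  assumes i: "i < n" "\<forall>j. to_nat (A j i) \<notin> T" and v: "A j a \<in> verts" "to_nat (A j a) \<notin> T"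
  shows "linked T (A j a) (A 0 i)"
proof -
  have "linked T (A j a) (A j i)"
    using linked_edge[of "CliqueA j a i" T] linked_edge[of "CliqueA j i a" T] linked_sym i v
    by (cases a i rule: linorder_cases) auto
  then show ?thesis using linked_trans linked_row_A[OF i] v by (meson A_in_verts)
qed

lemma linked_to_row_B:
  assumes i: "i < n" "\<forall>m. to_nat (B m i) \<notin> T" and v: "B m a \<in> verts" "to_nat (B m a) \<notin> T"
  shows "linked T (B m a) (B 0 i)"
proof -
  have "linked T (B m a) (B m i)"
    using linked_edge[of "CliqueB m a i" T] linked_edge[of "CliqueB m i a" T] linked_sym i v
    by (cases a i rule: linorder_cases) auto
  then show ?thesis using linked_trans linked_row_B[OF i] v by (meson B_in_verts)
qed

lemma surviving_link:
  assumes T: "finite T" "card T \<le> n - 1" "T \<noteq> S"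
  shows "\<exists>l. valid l \<and> (\<exists>k m. l = Link k m) \<and> to_nat (src l) \<notin> T \<and> to_nat (dst l) \<notin> T"
proof (rule ccontr)
  assume none: "\<not> ?thesis"
  define s where "s k = to_nat (A (int k) (n - 1))" for k
  define b where "b m = to_nat (B m (n - 1))" for m
  have b_in: "b m \<in> T" if "k \<in> sites" "s k \<notin> T" "m = k \<or> Suc m = k" for k m
    using none that unfolding s_def b_def by (metis dst.simps(6) src.simps(6) valid.simps(6))
  have "\<not> S \<subseteq> T" using T card_S card_subset_eq[of T S] card_mono[of T S] by auto
  then obtain k0 where k0: "k0 \<in> sites" "s k0 \<notin> T" by (auto simp: S_def s_def)
  \<comment> \<open>If every link is hit, each site is charged to an element of \<open>T\<close>: to
    itself or, if it survives, to its neighbour on its own level of \<open>B\<close>. The surviving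
    site \<open>k0\<close> also forces \<open>b (k0 - 1)\<close> into \<open>T\<close>. By the
    spacing no site is charged to that vertex, so \<open>T\<close> has at least \<open>n\<close>
    elements.\<close>
  define g where "g k = (if s k \<in> T then s k else b k)" for k
  have "b (k0 - 1) \<notin> g ` sites"
  proof
    assume "b (k0 - 1) \<in> g ` sites"
    then have "k0 - 1 \<in> sites" by (auto simp: g_def b_def s_def split: if_splits)
    then show False using sites_spaced[of "k0 - 1"] k0 site_bounds[of k0] by simp
  qed
  moreover have "inj_on g sites" by (auto simp: g_def b_def s_def inj_on_def)
  moreover have "finite sites" using sites_sub finite_subset by blast
  ultimately have "card (insert (b (k0 - 1)) (g ` sites)) = Suc (n - 1)"
    using card_sites by (simp add: card_image)
  moreover have "insert (b (k0 - 1)) (g ` sites) \<subseteq> T"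
    using b_in k0 site_bounds[of k0] by (auto simp: g_def)
  ultimately show False using T card_mono by (metis not_less_eq_eq)
qed

lemma small_set_not_cut:
  assumes T: "T \<subseteq> V" "card T \<le> n - 1" "T \<noteq> S"
  shows "\<not> vertex_cut V E T"
proof -
  have fin: "finite T" using T(1) finite_verts by (auto simp: V_def intro: finite_subset)
  have "card T < n" using T(2) n2 by simp
  then obtain i i' where i: "i < n" "\<forall>j. to_nat (A j i) \<notin> T" and i': "i' < n" "\<forall>m. to_nat (B m i') \<notin> T"
    using free_row[OF fin, of A] free_row[OF fin, of B] by blast
  obtain l k m where l: "valid l" "l = Link k m" "to_nat (src l) \<notin> T" "to_nat (dst l) \<notin> T"
    using surviving_link[OF fin T(2,3)] by blast
  \<comment> \<open>A free row of \<open>A\<close>, the surviving link and a free row of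
    \<open>B\<close> form a connected backbone to which all remaining vertices are attached.\<close>
  have "linked T (A 0 i) (src l)" "linked T (src l) (dst l)" "linked T (dst l) (B 0 i')"
    using l valid_ends[OF l(1)] linked_edge[OF l(1)] linked_to_row_A[OF i] linked_to_row_B[OF i'] linked_sym by auto
  then have AB: "linked T (A 0 i) (B 0 i')" using linked_trans by blast
  have all: "linked T v (A 0 i)" if "v \<in> verts" "to_nat v \<notin> T" for v
  proof (cases v)
    case (A j a)
    then show ?thesis using linked_to_row_A[OF i] that by blast
  next
    case (B m a)
    then have "linked T v (B 0 i')" using linked_to_row_B[OF i'] that by blast
    then show ?thesis using linked_trans linked_sym[OF AB] by blast
  qed
  have "(x, y) \<in> (adj_in (V - T) E)\<^sup>*" if xy: "x \<in> V - T" "y \<in> V - T" for x y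
  proof -
    obtain u v where "x = to_nat u" "u \<in> verts" "y = to_nat v" "v \<in> verts"
      using xy by (auto simp: V_def)
    then show ?thesis using all[of u] linked_sym[OF all[of v]] linked_trans xy by blast
  qed
  then show ?thesis unfolding vertex_cut_def by blast
qed

lemma S_cut: "vertex_cut V E S"
proof -
  have S: "S \<subseteq> V" using site_bounds n2 by (force simp: S_def V_def)
  \<comment> \<open>Only links leave \<open>A\<close>, and the end of each link in \<open>A\<close>
    belongs to \<open>S\<close>.\<close>
  have inv: "\<exists>j i. y = to_nat (A j i)" if "(x, y) \<in> (adj_in (V - S) E)\<^sup>*" "\<exists>j i. x = to_nat (A j i)" for x y
    using that
  proof (induction rule: rtrancl_induct)
    case (step y z)
    then obtain j i where y: "y = to_nat (A j i)" by blast
    from step(2) obtain l where l: "valid l" "{y, z} = edge l" and nS: "y \<notin> S" "z \<notin> S"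
      by (auto simp: adj_in_def E_def)
    show ?case
    proof (cases l)
      case (Link k m)
      then have "to_nat (A (int k) (n - 1)) \<in> S" using l(1) by (auto simp: S_def)
      then show ?thesis using l(2) nS Link by (auto simp: edge_def doubleton_eq_iff)
    qed (use l y in \<open>auto simp: edge_def doubleton_eq_iff\<close>)
  qed
  have "to_nat (A 0 0) \<in> V - S" "to_nat (B 0 0) \<in> V - S"
    using n2 site_bounds by (auto simp: V_def S_def)
  moreover have "(to_nat (A 0 0), to_nat (B 0 0)) \<notin> (adj_in (V - S) E)\<^sup>*"
    using inv by (metis to_nat_split vtx.distinct(1))
  ultimately show ?thesis unfolding vertex_cut_def using S by blast
qed

lemma unique_min_cut: "unique_min_vertex_cut V E S"
proof -
  have *: "T = S" if "vertex_cut V E T" "card T \<le> card S" for T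
    using small_set_not_cut[of T] that card_S by (auto simp: vertex_cut_def)
  have "min_vertex_cut V E S"
    unfolding min_vertex_cut_def using S_cut * by (metis linear)
  then show ?thesis
    unfolding unique_min_vertex_cut_def using * S_cut min_vertex_cut_def by blast
qed

end

section \<open>Placement of the vertices\<close>

lemma closed_segments_separated:
  fixes f :: "'a::real_vector \<Rightarrow> real"
  assumes "linear f" "f p < f p'" "f p < f q'" "f q < f p'" "f q < f q'"
  shows "closed_segment p q \<inter> closed_segment p' q' = {}"
proof (rule ccontr)
  assume "closed_segment p q \<inter> closed_segment p' q' \<noteq> {}"
  then obtain z where z: "z \<in> closed_segment p q" "z \<in> closed_segment p' q'" by blast
  have "f z \<in> closed_segment (f p) (f q)" "f z \<in> closed_segment (f p') (f q')"
    using z assms(1) by (auto simp: closed_segment_linear_image)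
  then show False using assms(2-) by (auto simp: closed_segment_eq_real_ivl split: if_splits)
qed

text \<open>The product is the excess of the chord over the parabola. Ladder \<open>A\<close> uses
  \<open>Re\<close> for \<open>f\<close> and \<open>Im\<close> for \<open>g\<close>, ladder
  \<open>B\<close> the reverse.\<close>

lemma parabola_chord:
  fixes f g :: "'a::real_vector \<Rightarrow> real"
  assumes lin: "linear f" "linear g" and z: "z \<in> closed_segment p q"
    and pq: "g p = c + (f p)\<^sup>2" "g q = c + (f q)\<^sup>2"
  shows "g z = c + (f z)\<^sup>2 + (f z - f p) * (f q - f z)"
proof -
  obtain s where s: "z = (1 - s) *\<^sub>R p + s *\<^sub>R q" using z by (auto simp: in_segment)
  have "f z = (1 - s) * f p + s * f q" "g z = (1 - s) * g p + s * g q"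
    unfolding s by (simp_all add: lin linear_add linear_scale)
  then show ?thesis unfolding pq by algebra
qed

text \<open>At a common point the two excesses over the parabola would agree, but over the range of
  the inner chord the outer chord has the larger excess.\<close>

lemma parabola_nested_chords_disjoint:
  fixes f g :: "'a::real_vector \<Rightarrow> real"
  assumes lin: "linear f" "linear g"
    and par: "\<And>x. x \<in> {p, q, p', q'} \<Longrightarrow> g x = c + (f x)\<^sup>2"
    and ord: "f p < f p'" "f p' < f q'" "f q' < f q"
  shows "closed_segment p q \<inter> closed_segment p' q' = {}"
proof (rule ccontr)
  assume "closed_segment p q \<inter> closed_segment p' q' \<noteq> {}"
  then obtain z where z: "z \<in> closed_segment p q" "z \<in> closed_segment p' q'" by blast
  have "f z \<in> closed_segment (f p') (f q')" using z lin by (simp add: closed_segment_linear_image)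
  then have r: "f p' \<le> f z" "f z \<le> f q'" using ord by (auto simp: closed_segment_eq_real_ivl)
  have "(f z - f p) * (f q - f z) = (f z - f p') * (f q' - f z)"
    using parabola_chord[OF lin z(1), of c] parabola_chord[OF lin z(2), of c] par by simp
  moreover have "(f z - f p') * (f q' - f z) \<le> (f z - f p') * (f q - f z)"
    using r ord by (intro mult_left_mono) auto
  moreover have "(f z - f p') * (f q - f z) < (f z - f p) * (f q - f z)"
    using r ord by (intro mult_strict_right_mono) auto
  ultimately show False by linarith
qed

text \<open>The segment from \<open>w\<close> to \<open>v\<close> is so steep that it stays below the parabola, while chords lie above it.\<close>

lemma parabola_chord_above_steep_segment:
  fixes f g :: "'a::real_vector \<Rightarrow> real"
  assumes lin: "linear f" "linear g"
    and par: "\<And>x. x \<in> {p, q, v} \<Longrightarrow> g x = c + (f x)\<^sup>2"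
    and ord: "f p < f v" "f v < f q" "f p < f w" "f w < f q"
    and close: "\<bar>f v - f w\<bar> \<le> 1" "\<bar>f v\<bar> \<le> M" "\<bar>f w\<bar> \<le> M" and steep: "g w + 2 * M \<le> g v"
  shows "closed_segment p q \<inter> closed_segment w v = {}"
proof (rule ccontr)
  assume "closed_segment p q \<inter> closed_segment w v \<noteq> {}"
  then obtain z where z: "z \<in> closed_segment p q" "z \<in> closed_segment w v" by blast
  obtain s where s: "0 \<le> s" "s \<le> 1" "z = (1 - s) *\<^sub>R w + s *\<^sub>R v" using z(2) by (auto simp: in_segment)
  have fz: "f z = (1 - s) * f w + s * f v" and gz: "g z = (1 - s) * g w + s * g v"
    unfolding s(3) by (simp_all add: lin linear_add linear_scale)
  have in_r: "f z \<in> closed_segment (f w) (f v)" using z(2) lin by (simp add: closed_segment_linear_image)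
  then have r: "f p < f z" "f z < f q" "\<bar>f z\<bar> \<le> M"
    using ord close by (auto simp: closed_segment_eq_real_ivl split: if_splits)
  have "g z = c + (f z)\<^sup>2 + (f z - f p) * (f q - f z)" using parabola_chord[OF lin z(1)] par by simp
  then have above: "c + (f z)\<^sup>2 < g z" using r by simp
  \<comment> \<open>Going back from \<open>v\<close> to \<open>z\<close>, the parabola falls by at
    most \<open>(1 - s) * (2 * M)\<close>, and the segment by at least as much.\<close>
  have "(f v)\<^sup>2 - (f z)\<^sup>2 = (1 - s) * ((f v - f w) * (f v + f z))"
    unfolding fz by algebra
  also have "\<dots> \<le> (1 - s) * (2 * M)"
  proof (rule mult_left_mono)
    have "(f v - f w) * (f v + f z) \<le> \<bar>f v - f w\<bar> * \<bar>f v + f z\<bar>" by (metis abs_ge_self abs_mult)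
    also have "\<dots> \<le> 1 * (2 * M)" using close r by (intro mult_mono) auto
    finally show "(f v - f w) * (f v + f z) \<le> 2 * M" by simp
  qed (use s in simp)
  also have "\<dots> \<le> (1 - s) * (g v - g w)" using s steep by (intro mult_left_mono) auto
  also have "\<dots> = g v - g z" unfolding gz by algebra
  finally have "g z \<le> c + (f z)\<^sup>2" using par[of v] by simp
  then show False using above by simp
qed

lemma linear_Re: "linear Re" and linear_Im: "linear Im"
  by (simp_all add: bounded_linear.linear bounded_linear_Re bounded_linear_Im)

lemma not_interlaced_cases:
  fixes a b c d :: nat
  assumes "a < b" "c < d" "a \<noteq> c \<and> a \<noteq> d \<and> b \<noteq> c \<and> b \<noteq> d"
    and "\<not> (a < c \<and> c < b \<and> b < d \<or> c < a \<and> a < d \<and> d < b)"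
  shows "b < c \<or> d < a \<or> c < a \<and> b < d \<or> a < c \<and> d < b"
  using assms by (cases "a < c"; cases "c < b"; cases "b < d"; cases "a < d"; simp)

text \<open>\<open>4 * x * y\<close> is at most the square of \<open>x + y\<close>, hence of
  \<open>2 * q - 1\<close>; the remaining quarter disappears because all terms are integers. The
  summand \<open>q\<close> on the left is spare room for further crossings.\<close>

lemma mult_le_square:
  fixes x y q :: nat
  assumes "x + y + 1 \<le> 2 * q"
  shows "x * y + q \<le> q * q"
proof -
  have "4 * (int x * int y) \<le> (int x + int y)\<^sup>2"
    using zero_le_power2[of "int x - int y"] by (simp add: power2_eq_square algebra_simps)
  also have "\<dots> \<le> (2 * int q - 1)\<^sup>2"
    using assms by (intro power_mono) auto
  finally have "4 * (int x * int y + int q) \<le> 4 * (int q * int q) + 1"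
    by (simp add: power2_eq_square algebra_simps)
  then have "int x * int y + int q \<le> int q * int q" by presburger
  then show ?thesis by (metis of_nat_add of_nat_le_iff of_nat_mult)
qed

text \<open>The distance from the middle of \<open>A\<close>: levels \<open>k\<close> and
  \<open>- 1 - k\<close> have the same depth \<open>k\<close>.\<close>

definition depth :: "int \<Rightarrow> nat" where "depth j = (if 0 \<le> j then nat j else nat (- 1 - j))"

section \<open>Coordinates of the vertices\<close>

context ladders
begin

text \<open>The spacing of the radii. The square covers the bend of the arcs of \<open>B\<close>,
  \<open>2 * n\<close> makes the matching edges of \<open>B\<close> flat enough to stay clear of the
  next clique, and 2 absorbs unit intervals.\<close>

definition G :: real where "G = real n ^ 2 + 2 * real n + 2"
text \<open>Both the half-width of \<open>A\<close> at depth \<open>k\<close> and the abscissa where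
  clique \<open>k\<close> of \<open>B\<close> begins, so that the right loop \<open>k\<close> passes
  just to the left of that clique.\<close>

definition rad :: "nat \<Rightarrow> real" where "rad k = (real k + 1) * G"
definition W :: real where "W = rad K"
text \<open>The vertical spacing of the levels of \<open>A\<close>: the square covers the height of
  an arc, \<open>4 * W\<close> outweighs the tilt of the long clique edges, and \<open>2 * n\<close>
  makes the matching edges steep.\<close>

definition H :: real where "H = W\<^sup>2 + 4 * W + 2 * real n"

text \<open>The left end of the unit interval for the arc parameter. Only rows 0 and
  \<open>n - 1\<close> of \<open>A\<close> move outwards with the depth; \<open>B\<close> occupies
  heights between \<open>- n\<close> and 0.\<close>

fun low :: "vtx \<Rightarrow> real" where
  "low (A j i) = (if i = 0 then - rad (depth j)
     else if i = n - 1 then rad (depth j) - 1 else real i)"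
| "low (B m i) = real i - real n"

text \<open>The parabolas open upwards for \<open>A\<close> and to the right for \<open>B\<close>,
  in the direction of growing level.\<close>

fun arc_of :: "vtx \<Rightarrow> complex set" where
  "arc_of (A j i) = (\<lambda>t. Complex t (H * real_of_int j + t\<^sup>2)) ` {low (A j i)<..<low (A j i) + 1}"
| "arc_of (B m i) = (\<lambda>t. Complex (rad m + t\<^sup>2) t) ` {low (B m i)<..<low (B m i) + 1}"

lemma placement_exists: "\<exists>P. (\<forall>v\<in>verts. P v \<in> arc_of v) \<and> inj_on P verts \<and> generic (P ` verts)"
proof (rule generic_choice[OF finite_verts])
  fix v
  show "infinite (arc_of v)"
    by (cases v) (auto simp del: low.simps dest!: finite_imageD simp: inj_on_def infinite_Ioo)
  fix a b :: complex assume "a \<noteq> b"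
  then show "finite {z \<in> arc_of v. orient a b z = 0}"
    using finite_parabola_Im_inter_line finite_parabola_Re_inter_line
    by (cases v) (simp_all del: low.simps)
qed

end

locale placed_ladders = ladders +
  fixes P :: "vtx \<Rightarrow> complex"
  assumes P_arc: "v \<in> verts \<Longrightarrow> P v \<in> arc_of v" and P_inj: "inj_on P verts" and P_generic: "generic (P ` verts)"
begin

section \<open>Inequalities between the coordinates\<close>

lemma A_parabola: "A j i \<in> verts \<Longrightarrow> Im (P (A j i)) = H * real_of_int j + (Re (P (A j i)))\<^sup>2"
  using P_arc[of "A j i"] by auto

lemma B_parabola: "B m i \<in> verts \<Longrightarrow> Re (P (B m i)) = rad m + (Im (P (B m i)))\<^sup>2"
  using P_arc[of "B m i"] by auto

lemma A_low: "A j i \<in> verts \<Longrightarrow> low (A j i) < Re (P (A j i)) \<and> Re (P (A j i)) < low (A j i) + 1"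
  using P_arc[of "A j i"] by (auto simp del: low.simps)

lemma B_low: "B m i \<in> verts \<Longrightarrow> real i - real n < Im (P (B m i)) \<and> Im (P (B m i)) < real i - real n + 1"
  using P_arc[of "B m i"] by auto

lemma G_bounds: "real n ^ 2 + 2 * real n + 2 \<le> G" "real n + 2 \<le> G" "0 < G"
  unfolding G_def using zero_le_power2[of "real n"] by linarith+

lemma depth_le: "A j i \<in> verts \<Longrightarrow> depth j \<le> K"
  by (auto simp: depth_def)

lemma rad_ge: "G \<le> rad k"
  using G_bounds by (simp add: rad_def)

lemma rad_mono: "m \<le> m' \<Longrightarrow> rad m \<le> rad m'"
  unfolding rad_def using G_bounds by (intro mult_right_mono) auto

lemma rad_less: "m < m' \<Longrightarrow> rad m + G \<le> rad m'"
  using rad_mono[of "Suc m" m'] by (simp add: rad_def algebra_simps)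

lemma depth_W: "A j i \<in> verts \<Longrightarrow> rad (depth j) \<le> W"
  unfolding W_def using depth_le rad_mono by blast

lemma G_le_W: "G \<le> W"
  unfolding W_def by (rule rad_ge)

lemma A_Re_bound: assumes "A j i \<in> verts" shows "\<bar>Re (P (A j i))\<bar> < W"
proof -
  have "i < n" using assms by simp
  then have "real i + 1 \<le> real n" by simp
  then show ?thesis using A_low[OF assms] depth_W[OF assms] rad_ge[of "depth j"] G_bounds G_le_W
    by (auto split: if_splits)
qed

lemma A_Re_sq: "A j i \<in> verts \<Longrightarrow> (Re (P (A j i)))\<^sup>2 < W\<^sup>2"
  using A_Re_bound[of j i] by (metis abs_ge_zero power2_abs power_strict_mono zero_less_numeral)

lemma B_Im_bound: "B m i \<in> verts \<Longrightarrow> - real n < Im (P (B m i)) \<and> Im (P (B m i)) < 0"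
proof -
  assume v: "B m i \<in> verts"
  then have "i < n" by simp
  then have "real i + 1 \<le> real n" by simp
  then show ?thesis using B_low[OF v] by auto
qed

lemma B_Re_bound: assumes "B m i \<in> verts"
  shows "rad m \<le> Re (P (B m i))" "Re (P (B m i)) < rad m + real n ^ 2"
proof -
  have "\<bar>Im (P (B m i))\<bar> < real n" using B_Im_bound[OF assms] by auto
  then have "(Im (P (B m i)))\<^sup>2 < real n ^ 2" by (metis abs_ge_zero power2_abs power_strict_mono zero_less_numeral)
  then show "rad m \<le> Re (P (B m i))" "Re (P (B m i)) < rad m + real n ^ 2"
    using B_parabola[OF assms] by auto
qed

text \<open>The levels are arbitrary: the rows of \<open>A\<close> occupy disjoint vertical strips,
  since every radius leaves room for the \<open>n\<close> inner unit intervals.\<close>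

lemma A_row:
  assumes "i < i'" "A j i \<in> verts" "A j' i' \<in> verts"
  shows "Re (P (A j i)) < Re (P (A j' i'))"
proof -
  have "i' < n" using assms by simp
  then have "real i + 1 \<le> real i'" "real i' + 1 \<le> real n" using assms(1) by simp_all
  then show ?thesis
    using A_low[OF assms(2)] A_low[OF assms(3)] rad_ge[of "depth j"] rad_ge[of "depth j'"] G_bounds assms(1) \<open>i' < n\<close>
    by (auto split: if_splits)
qed

text \<open>The square in \<open>H\<close> exceeds the rise of the lower vertex along its parabola,
  which leaves \<open>4 * W\<close>.\<close>

lemma A_gap:
  assumes "j < j'" "A j i \<in> verts" "A j' i' \<in> verts"
  shows "Im (P (A j i)) + 4 * W \<le> Im (P (A j' i'))"
proof -
  have W: "0 \<le> W" using G_le_W G_bounds by linarith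
  have "real_of_int j + 1 \<le> real_of_int j'" using assms(1) by linarith
  then have "H * (real_of_int j + 1) \<le> H * real_of_int j'"
    using W by (intro mult_left_mono) (auto simp: H_def)
  then have "H * real_of_int j + H \<le> H * real_of_int j'" by (simp add: distrib_left)
  moreover have "W\<^sup>2 + 4 * W \<le> H" by (simp add: H_def)
  ultimately show ?thesis using A_parabola[OF assms(2)] A_parabola[OF assms(3)] A_Re_sq[OF assms(2)]
      zero_le_power2[of "Re (P (A j' i'))"] by linarith
qed

lemma A_level:
  assumes "j < j'" "A j i \<in> verts" "A j' i' \<in> verts"
  shows "Im (P (A j i)) < Im (P (A j' i'))"
  using A_gap[OF assms] G_le_W G_bounds by linarith

lemma A_flare_right:
  assumes "depth j < depth j'" "A j i \<in> verts" "A j' i' \<in> verts" "i' = n - 1"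
  shows "Re (P (A j i)) < Re (P (A j' i'))"
proof (cases "i = n - 1")
  case True
  then show ?thesis using assms A_low[OF assms(2)] A_low[OF assms(3)] n2 rad_less[OF assms(1)] G_bounds
    by auto
next
  case False
  then have "i < i'" using assms by auto
  then show ?thesis using A_row assms by blast
qed

lemma A_flare_left:
  assumes "depth j < depth j'" "A j i \<in> verts" "A j' i' \<in> verts" "i' = 0"
  shows "Re (P (A j' i')) < Re (P (A j i))"
proof (cases "i = 0")
  case True
  then show ?thesis using assms A_low[OF assms(2)] A_low[OF assms(3)] n2 rad_less[OF assms(1)] G_bounds
    by auto
next
  case False
  then have "i' < i" using assms by auto
  then show ?thesis using A_row assms by blast
qed

lemma B_row:
  assumes "i < i'" "B m i \<in> verts" "B m' i' \<in> verts"
  shows "Im (P (B m i)) < Im (P (B m' i'))"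
  using B_low[OF assms(2)] B_low[OF assms(3)] assms(1) by linarith

lemma B_level:
  assumes "m < m'" "B m i \<in> verts" "B m' i' \<in> verts"
  shows "Re (P (B m i)) < Re (P (B m' i'))"
  using B_Re_bound[OF assms(2)] B_Re_bound[OF assms(3)] rad_less[OF assms(1)] G_bounds by linarith

text \<open>Together with \<open>A_below_B\<close> this confines \<open>B\<close> to the horizontal
  strip between levels -1 and 0 of \<open>A\<close>.\<close>

lemma B_below_A:
  assumes "0 \<le> j" "A j i \<in> verts" "B m i' \<in> verts"
  shows "Im (P (B m i')) < Im (P (A j i))"
proof -
  have "0 \<le> H" using G_le_W G_bounds by (simp add: H_def)
  then have "0 \<le> H * real_of_int j" using assms(1) by simp
  then show ?thesis using A_parabola[OF assms(2)] B_Im_bound[OF assms(3)] by (smt (verit) zero_le_power2)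
qed

lemma A_below_B:
  assumes "j < 0" "A j i \<in> verts" "B m i' \<in> verts"
  shows "Im (P (A j i)) < Im (P (B m i'))"
proof -
  have W: "0 \<le> W" using G_le_W G_bounds by linarith
  have "H * real_of_int j \<le> H * (- 1)" using assms(1) W by (intro mult_left_mono) (auto simp: H_def)
  moreover have "W\<^sup>2 + real n \<le> H" using W by (simp add: H_def)
  ultimately show ?thesis using A_parabola[OF assms(2)] A_Re_sq[OF assms(2)] B_Im_bound[OF assms(3)] by linarith
qed

text \<open>Only the right ends of levels deeper than \<open>m\<close> reach beyond clique
  \<open>m\<close> of \<open>B\<close>; that case is \<open>B_left_A\<close>.\<close>

lemma A_left_B:
  assumes "i < n - 1 \<or> depth j \<le> m" "A j i \<in> verts" "B m i' \<in> verts"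
  shows "Re (P (A j i)) < Re (P (B m i'))"
proof -
  have m: "G \<le> rad m" by (rule rad_ge)
  show ?thesis
  proof (cases "i < n - 1")
    case True
    then have "real i + 1 \<le> real n" by linarith
    then show ?thesis using A_low[OF assms(2)] B_Re_bound[OF assms(3)] m True G_bounds rad_ge[of "depth j"]
      by (auto split: if_splits)
  next
    case False
    then have "i = n - 1" "i \<noteq> 0" "depth j \<le> m" using assms n2 by auto
    moreover have "rad (depth j) \<le> rad m" using \<open>depth j \<le> m\<close> by (rule rad_mono)
    ultimately show ?thesis using A_low[OF assms(2)] B_Re_bound[OF assms(3)] by auto
  qed
qed

lemma B_left_A:
  assumes "m < depth j" "i = n - 1" "A j i \<in> verts" "B m i' \<in> verts"
  shows "Re (P (B m i')) < Re (P (A j i))"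
  using A_low[OF assms(3)] B_Re_bound[OF assms(4)] rad_less[OF assms(1)] G_bounds assms(2) n2
  by auto

abbreviation seg :: "vtx \<Rightarrow> vtx \<Rightarrow> complex set" where
  "seg u v \<equiv> closed_segment (P u) (P v)"

lemmas sep_Re = closed_segments_separated[OF linear_Re]
lemmas sep_Im = closed_segments_separated[OF linear_Im]

lemma sep_Re': "Re (P c) < Re (P a) \<Longrightarrow> Re (P d) < Re (P a) \<Longrightarrow> Re (P c) < Re (P b) \<Longrightarrow> Re (P d) < Re (P b)
    \<Longrightarrow> seg a b \<inter> seg c d = {}"
  using sep_Re[of "P c" "P a" "P b" "P d"] by blast

lemma sep_Im': "Im (P c) < Im (P a) \<Longrightarrow> Im (P d) < Im (P a) \<Longrightarrow> Im (P c) < Im (P b) \<Longrightarrow> Im (P d) < Im (P b)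
    \<Longrightarrow> seg a b \<inter> seg c d = {}"
  using sep_Im[of "P c" "P a" "P b" "P d"] by blast

subsection \<open>Which edges cross\<close>

definition lseg :: "lab \<Rightarrow> complex set" where "lseg l = seg (src l) (dst l)"

definition indep :: "lab \<Rightarrow> lab \<Rightarrow> bool" where "indep l l' \<longleftrightarrow> {src l, dst l} \<inter> {src l', dst l'} = {}"

lemma indep_sym: "indep l l' \<Longrightarrow> indep l' l"
  by (auto simp: indep_def)

lemma depth_simps [simp]: "depth (int k) = k" "depth (- 1 - int k) = k"
  by (auto simp: depth_def)

text \<open>Different levels are separated by height, disjoint index ranges by abscissa, and nested
  ranges by the parabola; only interlacing remains.\<close>

lemma CliqueA_CliqueA:
  assumes v: "valid (CliqueA j a b)" "valid (CliqueA j' c d)" and i: "indep (CliqueA j a b) (CliqueA j' c d)"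
    and meet: "lseg (CliqueA j a b) \<inter> lseg (CliqueA j' c d) \<noteq> {}"
  shows "j = j' \<and> (a < c \<and> c < b \<and> b < d \<or> c < a \<and> a < d \<and> d < b)"
proof (rule ccontr)
  assume neg: "\<not> ?thesis"
  have "a < b" "c < d" "j = j' \<Longrightarrow> a \<noteq> c \<and> a \<noteq> d \<and> b \<noteq> c \<and> b \<noteq> d"
    using v i by (auto simp: indep_def)
  then consider "j < j'" | "j' < j" | "j = j'" "b < c" | "j = j'" "d < a" | "j = j'" "c < a" "b < d" | "j = j'" "a < c" "d < b"
    using neg not_interlaced_cases[of a b c d] by (cases j j' rule: linorder_cases) blast+
  then have "lseg (CliqueA j a b) \<inter> lseg (CliqueA j' c d) = {}"
  proof cases
    case 1 then show ?thesis unfolding lseg_def src.simps dst.simps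
      using v by (intro sep_Im A_level) auto
  next
    case 2 then show ?thesis unfolding lseg_def src.simps dst.simps
      using v by (intro sep_Im' A_level) auto
  next
    case 3 then show ?thesis unfolding lseg_def src.simps dst.simps
      using v by (intro sep_Re A_row) auto
  next
    case 4 then show ?thesis unfolding lseg_def src.simps dst.simps
      using v by (intro sep_Re' A_row) auto
  next
    case 5
    have "seg (A j c) (A j d) \<inter> seg (A j a) (A j b) = {}"
      using 5 v by (intro parabola_nested_chords_disjoint[OF linear_Re linear_Im, of _ _ _ _ "H * real_of_int j"] A_row)
        (auto simp: A_parabola B_parabola)
    then show ?thesis using 5 by (auto simp: lseg_def)
  next
    case 6
    have "seg (A j a) (A j b) \<inter> seg (A j c) (A j d) = {}"
      using 6 v by (intro parabola_nested_chords_disjoint[OF linear_Re linear_Im, of _ _ _ _ "H * real_of_int j"] A_row)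
        (auto simp: A_parabola B_parabola)
    then show ?thesis using 6 by (auto simp: lseg_def)
  qed
  then show False using meet by blast
qed

text \<open>A matching edge leaves its lower arc upwards through the chords, but reaches its upper
  arc from below, where there are no chords.\<close>

lemma CliqueA_MatchA:
  assumes v: "valid (CliqueA j a b)" "valid (MatchA j' i)" and ind: "indep (CliqueA j a b) (MatchA j' i)"
    and meet: "lseg (CliqueA j a b) \<inter> lseg (MatchA j' i) \<noteq> {}"
  shows "j' = j \<and> a < i \<and> i < b"
proof (rule ccontr)
  assume neg: "\<not> ?thesis"
  have "j = j' \<or> j = j' + 1 \<Longrightarrow> a \<noteq> i \<and> b \<noteq> i" using ind by (auto simp: indep_def)
  then consider "j < j'" | "j' + 1 < j" | "i < a" | "b < i" | "j = j' + 1" "a < i" "i < b"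
    using neg by linarith
  then have "lseg (CliqueA j a b) \<inter> lseg (MatchA j' i) = {}"
  proof cases
    case 1 then show ?thesis unfolding lseg_def src.simps dst.simps
      using v by (intro sep_Im A_level) auto
  next
    case 2 then show ?thesis unfolding lseg_def src.simps dst.simps
      using v by (intro sep_Im' A_level) auto
  next
    case 3 then show ?thesis unfolding lseg_def src.simps dst.simps
      using v by (intro sep_Re' A_row) auto
  next
    case 4 then show ?thesis unfolding lseg_def src.simps dst.simps
      using v by (intro sep_Re A_row) auto
  next
    case 5
    have vs: "A j a \<in> verts" "A j b \<in> verts" "A j i \<in> verts" "A j' i \<in> verts" using v 5 by auto
    \<comment> \<open>A row strictly between two others does not flare, so both ends of the matching
      edge lie over the same unit interval.\<close>
    have i: "i \<noteq> 0" "i \<noteq> n - 1" "i < n" using 5 v by auto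
    then have n: "real i + 1 \<le> real n" by linarith
    have W: "0 \<le> W" using G_le_W G_bounds by linarith
    have low: "real i < Re (P (A j i))" "Re (P (A j i)) < real i + 1" "real i < Re (P (A j' i))" "Re (P (A j' i)) < real i + 1"
      using A_low[OF vs(3)] A_low[OF vs(4)] i by auto
    have "Im (P (A j i)) = Im (P (A j' i)) + H + (Re (P (A j i)))\<^sup>2 - (Re (P (A j' i)))\<^sup>2"
      using A_parabola[OF vs(3)] A_parabola[OF vs(4)] 5(1) by (simp add: algebra_simps)
    moreover have "W\<^sup>2 + 2 * real n \<le> H" using W by (simp add: H_def)
    ultimately have steep: "Im (P (A j' i)) + 2 * real n \<le> Im (P (A j i))"
      using A_Re_sq[OF vs(4)] zero_le_power2[of "Re (P (A j i))"] by linarith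
    have "seg (A j a) (A j b) \<inter> seg (A j' i) (A j i) = {}"
      by (rule parabola_chord_above_steep_segment[OF linear_Re linear_Im, of _ _ _ "H * real_of_int j" _ "real n"])
        (use A_row[of a i j j] A_row[of a i j j'] A_row[of i b j j] A_row[of i b j' j] 5 vs A_parabola low n steep in auto)
    then show ?thesis using 5 by (auto simp: lseg_def)
  qed
  then show False using meet by blast
qed

text \<open>Flaring carries the loop past all shallower levels, and deeper levels lie above or below
  it. On its own levels, independence excludes the row of the loop and leaves the other rows on one
  side.\<close>

lemma CliqueA_Loop:
  assumes v: "valid (CliqueA j a b)" "valid (Loop k i)" and ind: "indep (CliqueA j a b) (Loop k i)"
  shows "lseg (CliqueA j a b) \<inter> lseg (Loop k i) = {}"
proof -
  consider "depth j < k" "i = 0" | "depth j < k" "i = n - 1" | "int k < j" | "j < - 1 - int k"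
    | "j = int k \<or> j = - 1 - int k" "i = 0" | "j = int k \<or> j = - 1 - int k" "i = n - 1"
  proof -
    have "depth j < k \<or> int k < j \<or> j < - 1 - int k \<or> j = int k \<or> j = - 1 - int k"
      by (auto simp: depth_def)
    then show ?thesis using v that by auto
  qed
  then show ?thesis
  proof cases
    case 1 then show ?thesis unfolding lseg_def src.simps dst.simps
      using v by (intro sep_Re' A_flare_left) auto
  next
    case 2 then show ?thesis unfolding lseg_def src.simps dst.simps
      using v by (intro sep_Re A_flare_right) auto
  next
    case 3 then show ?thesis unfolding lseg_def src.simps dst.simps
      using v by (intro sep_Im' A_level) auto
  next
    case 4 then show ?thesis unfolding lseg_def src.simps dst.simps
      using v by (intro sep_Im A_level) auto
  next
    case 5
    then have "0 < a" "0 < b" using ind by (auto simp: indep_def)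
    then show ?thesis unfolding lseg_def src.simps dst.simps
      using v 5 by (intro sep_Re' A_row) auto
  next
    case 6
    then have "a < n - 1" "b < n - 1" using ind v by (auto simp: indep_def)
    then show ?thesis unfolding lseg_def src.simps dst.simps
      using v 6 by (intro sep_Re A_row) auto
  qed
qed

lemma CliqueA_CliqueB:
  assumes v: "valid (CliqueA j a b)" "valid (CliqueB m c d)"
  shows "lseg (CliqueA j a b) \<inter> lseg (CliqueB m c d) = {}"
proof (cases "0 \<le> j")
  case True then show ?thesis unfolding lseg_def src.simps dst.simps
    using v by (intro sep_Im' B_below_A) auto
next
  case False then show ?thesis unfolding lseg_def src.simps dst.simps
    using v by (intro sep_Im A_below_B) auto
qed

lemma CliqueA_MatchB:
  assumes v: "valid (CliqueA j a b)" "valid (MatchB m i)"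
  shows "lseg (CliqueA j a b) \<inter> lseg (MatchB m i) = {}"
proof (cases "0 \<le> j")
  case True then show ?thesis unfolding lseg_def src.simps dst.simps
    using v by (intro sep_Im' B_below_A) auto
next
  case False then show ?thesis unfolding lseg_def src.simps dst.simps
    using v by (intro sep_Im A_below_B) auto
qed

lemma valid_LinkD: "valid (Link k m) \<Longrightarrow> 1 \<le> k \<and> k \<le> K \<and> m \<le> k \<and> k \<le> Suc m"
  using site_bounds by auto

text \<open>A link stays between the bottom of the strip of \<open>B\<close> and level
  \<open>k\<close>. Lower levels from 0 on end to its left, and on level \<open>k\<close>
  independence leaves only rows left of the site.\<close>

lemma CliqueA_Link:
  assumes v: "valid (CliqueA j a b)" "valid (Link k m)" and ind: "indep (CliqueA j a b) (Link k m)"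
  shows "lseg (CliqueA j a b) \<inter> lseg (Link k m) = {}"
proof -
  note k = valid_LinkD[OF v(2)]
  consider "j < 0" | "int k < j" | "0 \<le> j" "j < int k" | "j = int k" by linarith
  then show ?thesis
  proof cases
    case 1 then show ?thesis unfolding lseg_def src.simps dst.simps
      using v k n2 by (intro sep_Im A_below_B A_level) auto
  next
    case 2 then show ?thesis unfolding lseg_def src.simps dst.simps
      using v k n2 by (intro sep_Im' B_below_A A_level) auto
  next
    case 3
    then have "depth j < k" "depth j \<le> m" using k by (auto simp: depth_def)
    then show ?thesis unfolding lseg_def src.simps dst.simps
      using v k n2 3 by (intro sep_Re A_left_B A_flare_right) auto
  next
    case 4
    then have "a < n - 1" "b < n - 1" using ind v by (auto simp: indep_def)
    then show ?thesis unfolding lseg_def src.simps dst.simps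
      using v k n2 4 by (intro sep_Re A_left_B A_row) auto
  qed
qed

lemma MatchA_MatchA:
  assumes v: "valid (MatchA j i)" "valid (MatchA j' i')" and ind: "indep (MatchA j i) (MatchA j' i')"
  shows "lseg (MatchA j i) \<inter> lseg (MatchA j' i') = {}"
proof -
  have "i = i' \<Longrightarrow> j \<noteq> j' \<and> j + 1 \<noteq> j' \<and> j' + 1 \<noteq> j" using ind by (auto simp: indep_def)
  then consider "i < i'" | "i' < i" | "j + 1 < j'" | "j' + 1 < j" by linarith
  then show ?thesis
  proof cases
    case 1 then show ?thesis unfolding lseg_def src.simps dst.simps
      using v by (intro sep_Re A_row) auto
  next
    case 2 then show ?thesis unfolding lseg_def src.simps dst.simps
      using v by (intro sep_Re' A_row) auto
  next
    case 3 then show ?thesis unfolding lseg_def src.simps dst.simps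
      using v by (intro sep_Im A_level) auto
  next
    case 4 then show ?thesis unfolding lseg_def src.simps dst.simps
      using v by (intro sep_Im' A_level) auto
  qed
qed

lemma MatchA_Loop:
  assumes v: "valid (MatchA j i')" "valid (Loop k i)" and ind: "indep (MatchA j i') (Loop k i)"
  shows "lseg (MatchA j i') \<inter> lseg (Loop k i) = {}"
proof -
  have j: "j \<noteq> int k \<and> j \<noteq> - 1 - int k \<and> j + 1 \<noteq> int k \<and> j + 1 \<noteq> - 1 - int k" if "i = i'"
    using ind that by (auto simp: indep_def)
  consider "i = 0" "0 < i'" | "i = n - 1" "i' < n - 1" | "i = i'" "int k < j" | "i = i'" "j + 1 < - 1 - int k"
    | "i = i'" "depth j < k" "depth (j + 1) < k"
  proof -
    have "depth j < k \<and> depth (j + 1) < k" if "i = i'" "\<not> int k < j" "\<not> j + 1 < - 1 - int k"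
      using j[OF that(1)] that(2,3) by (auto simp: depth_def)
    moreover have "i' < n" "i = 0 \<or> i = n - 1" using v by auto
    ultimately show ?thesis using that by (cases "i = i'") auto
  qed
  then show ?thesis
  proof cases
    case 1 then show ?thesis unfolding lseg_def src.simps dst.simps
      using v by (intro sep_Re' A_row) auto
  next
    case 2 then show ?thesis unfolding lseg_def src.simps dst.simps
      using v by (intro sep_Re A_row) auto
  next
    case 3 then show ?thesis unfolding lseg_def src.simps dst.simps
      using v by (intro sep_Im' A_level) auto
  next
    case 4 then show ?thesis unfolding lseg_def src.simps dst.simps
      using v by (intro sep_Im A_level) auto
  next
    case 5
    show ?thesis
    proof (cases "i = 0")
      case True
      then show ?thesis unfolding lseg_def src.simps dst.simps
        using v 5 by (intro sep_Re' A_flare_left) auto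
    next
      case False
      then show ?thesis unfolding lseg_def src.simps dst.simps
        using v 5 by (intro sep_Re A_flare_right) auto
    qed
  qed
qed

text \<open>Only matching edges from level -1 to level 0 traverse the strip of \<open>B\<close>; at
  depth 0 they are still to the left of all of \<open>B\<close>.\<close>

lemma MatchA_B:
  assumes v: "valid (MatchA j i)" "B m c \<in> verts" "B m' d \<in> verts"
  shows "lseg (MatchA j i) \<inter> seg (B m c) (B m' d) = {}"
proof -
  consider "0 \<le> j" | "j + 1 < 0" | "j = - 1" by linarith
  then show ?thesis
  proof cases
    case 1 then show ?thesis unfolding lseg_def src.simps dst.simps
      using v by (intro sep_Im' B_below_A) auto
  next
    case 2 then show ?thesis unfolding lseg_def src.simps dst.simps
      using v by (intro sep_Im A_below_B) auto
  next
    case 3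
    then have "depth j = 0" "depth (j + 1) = 0" by (auto simp: depth_def)
    then show ?thesis unfolding lseg_def src.simps dst.simps
      using v 3 by (intro sep_Re A_left_B) auto
  qed
qed

lemma MatchA_Link:
  assumes v: "valid (MatchA j i)" "valid (Link k m)" and ind: "indep (MatchA j i) (Link k m)"
  shows "lseg (MatchA j i) \<inter> lseg (Link k m) = {}"
proof -
  note k = valid_LinkD[OF v(2)]
  consider "i < n - 1" | "int k < j" | "j + 1 < 0" | "i = n - 1" "depth j < k" "depth (j + 1) < k"
  proof -
    have "depth j < k \<and> depth (j + 1) < k" if "i = n - 1" "\<not> int k < j" "\<not> j + 1 < 0"
      using ind that k by (auto simp: depth_def indep_def)
    moreover have "i < n" using v by simp
    ultimately show ?thesis using that by (metis Suc_pred' less_SucE less_nat_zero_code neq0_conv)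
  qed
  then show ?thesis
  proof cases
    case 1 then show ?thesis unfolding lseg_def src.simps dst.simps
      using v k n2 by (intro sep_Re A_left_B A_row) auto
  next
    case 2 then show ?thesis unfolding lseg_def src.simps dst.simps
      using v k n2 by (intro sep_Im' B_below_A A_level) auto
  next
    case 3 then show ?thesis unfolding lseg_def src.simps dst.simps
      using v k n2 by (intro sep_Im A_below_B A_level) auto
  next
    case 4 then show ?thesis unfolding lseg_def src.simps dst.simps
      using v k n2 by (intro sep_Re A_left_B A_flare_right) auto
  qed
qed

lemma Loop_Loop:
  assumes v: "valid (Loop k i)" "valid (Loop k' i')" and ind: "indep (Loop k i) (Loop k' i')"
  shows "lseg (Loop k i) \<inter> lseg (Loop k' i') = {}"
proof -
  consider "i < i'" | "i' < i" | "i = 0" "i' = 0" "k < k'" | "i = 0" "i' = 0" "k' < k"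
    | "i = n - 1" "i' = n - 1" "k < k'" | "i = n - 1" "i' = n - 1" "k' < k"
  proof -
    have "i = i' \<Longrightarrow> k \<noteq> k'" "i = 0 \<or> i = n - 1" "i' = 0 \<or> i' = n - 1" using ind v by (auto simp: indep_def)
    then show ?thesis using that by (metis linorder_neqE_nat)
  qed
  then show ?thesis
  proof cases
    case 1 then show ?thesis unfolding lseg_def src.simps dst.simps
      using v by (intro sep_Re A_row) auto
  next
    case 2 then show ?thesis unfolding lseg_def src.simps dst.simps
      using v by (intro sep_Re' A_row) auto
  next
    case 3 then show ?thesis unfolding lseg_def src.simps dst.simps
      using v by (intro sep_Re' A_flare_left) auto
  next
    case 4 then show ?thesis unfolding lseg_def src.simps dst.simps
      using v by (intro sep_Re A_flare_left) auto
  next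
    case 5 then show ?thesis unfolding lseg_def src.simps dst.simps
      using v by (intro sep_Re A_flare_right) auto
  next
    case 6 then show ?thesis unfolding lseg_def src.simps dst.simps
      using v by (intro sep_Re' A_flare_right) auto
  qed
qed

lemma Loop_CliqueB:
  assumes v: "valid (Loop k i)" "valid (CliqueB m c d)"
  shows "lseg (Loop k i) \<inter> lseg (CliqueB m c d) = {}"
proof -
  have "i = 0 \<or> i = n - 1" using v by simp
  then consider "i = 0" | "k \<le> m" | "i = n - 1" "m < k" by linarith
  then show ?thesis
  proof cases
    case 1 then show ?thesis unfolding lseg_def src.simps dst.simps
      using v by (intro sep_Re A_left_B) auto
  next
    case 2 then show ?thesis unfolding lseg_def src.simps dst.simps
      using v by (intro sep_Re A_left_B) auto
  next
    case 3 then show ?thesis unfolding lseg_def src.simps dst.simps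
      using v by (intro sep_Re' B_left_A) auto
  qed
qed

text \<open>The right loop \<open>k\<close> runs in the gap between cliques \<open>k - 1\<close> and
  \<open>k\<close> of \<open>B\<close>, so only the matching edges that bridge this gap can meet
  it.\<close>

lemma Loop_MatchB:
  assumes v: "valid (Loop k i)" "valid (MatchB m i')" and meet: "lseg (Loop k i) \<inter> lseg (MatchB m i') \<noteq> {}"
  shows "i = n - 1 \<and> k = Suc m"
proof (rule ccontr)
  assume neg: "\<not> ?thesis"
  have "i = 0 \<or> i = n - 1" using v by simp
  then consider "i = 0" | "k \<le> m" | "i = n - 1" "Suc m < k" using neg by linarith
  then have "lseg (Loop k i) \<inter> lseg (MatchB m i') = {}"
  proof cases
    case 1 then show ?thesis unfolding lseg_def src.simps dst.simps
      using v by (intro sep_Re A_left_B) auto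
  next
    case 2 then show ?thesis unfolding lseg_def src.simps dst.simps
      using v by (intro sep_Re A_left_B) auto
  next
    case 3 then show ?thesis unfolding lseg_def src.simps dst.simps
      using v by (intro sep_Re' B_left_A) auto
  qed
  then show False using meet by blast
qed

lemma Loop_Link:
  assumes v: "valid (Loop k i)" "valid (Link k' m)" and ind: "indep (Loop k i) (Link k' m)"
  shows "lseg (Loop k i) \<inter> lseg (Link k' m) = {}"
proof -
  note k = valid_LinkD[OF v(2)]
  have "i = 0 \<or> i = n - 1" "i = n - 1 \<Longrightarrow> k \<noteq> k'" using v ind by (auto simp: indep_def)
  then consider "i = 0" | "k < k'" | "i = n - 1" "k' < k" by linarith
  then show ?thesis
  proof cases
    case 1 then show ?thesis unfolding lseg_def src.simps dst.simps
      using v k by (intro sep_Re A_left_B A_row) auto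
  next
    case 2 then show ?thesis unfolding lseg_def src.simps dst.simps
      using v k by (intro sep_Re A_left_B A_flare_right) auto
  next
    case 3 then show ?thesis unfolding lseg_def src.simps dst.simps
      using v k by (intro sep_Re' B_left_A A_flare_right) auto
  qed
qed

lemma CliqueB_CliqueB:
  assumes v: "valid (CliqueB m a b)" "valid (CliqueB m' c d)" and i: "indep (CliqueB m a b) (CliqueB m' c d)"
    and meet: "lseg (CliqueB m a b) \<inter> lseg (CliqueB m' c d) \<noteq> {}"
  shows "m = m' \<and> (a < c \<and> c < b \<and> b < d \<or> c < a \<and> a < d \<and> d < b)"
proof (rule ccontr)
  assume neg: "\<not> ?thesis"
  have "a < b" "c < d" "m = m' \<Longrightarrow> a \<noteq> c \<and> a \<noteq> d \<and> b \<noteq> c \<and> b \<noteq> d"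
    using v i by (auto simp: indep_def)
  then consider "m < m'" | "m' < m" | "m = m'" "b < c" | "m = m'" "d < a" | "m = m'" "c < a" "b < d" | "m = m'" "a < c" "d < b"
    using neg not_interlaced_cases[of a b c d] by (cases m m' rule: linorder_cases) blast+
  then have "lseg (CliqueB m a b) \<inter> lseg (CliqueB m' c d) = {}"
  proof cases
    case 1 then show ?thesis unfolding lseg_def src.simps dst.simps
      using v by (intro sep_Re B_level) auto
  next
    case 2 then show ?thesis unfolding lseg_def src.simps dst.simps
      using v by (intro sep_Re' B_level) auto
  next
    case 3 then show ?thesis unfolding lseg_def src.simps dst.simps
      using v by (intro sep_Im B_row) auto
  next
    case 4 then show ?thesis unfolding lseg_def src.simps dst.simps
      using v by (intro sep_Im' B_row) auto
  next
    case 5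
    have "seg (B m c) (B m d) \<inter> seg (B m a) (B m b) = {}"
      using 5 v by (intro parabola_nested_chords_disjoint[OF linear_Im linear_Re, of _ _ _ _ "rad m"] B_row)
        (auto simp: A_parabola B_parabola)
    then show ?thesis using 5 by (auto simp: lseg_def)
  next
    case 6
    have "seg (B m a) (B m b) \<inter> seg (B m c) (B m d) = {}"
      using 6 v by (intro parabola_nested_chords_disjoint[OF linear_Im linear_Re, of _ _ _ _ "rad m"] B_row)
        (auto simp: A_parabola B_parabola)
    then show ?thesis using 6 by (auto simp: lseg_def)
  qed
  then show False using meet by blast
qed

lemma CliqueB_MatchB:
  assumes v: "valid (CliqueB m a b)" "valid (MatchB m' i)" and ind: "indep (CliqueB m a b) (MatchB m' i)"
    and meet: "lseg (CliqueB m a b) \<inter> lseg (MatchB m' i) \<noteq> {}"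
  shows "m' = m \<and> a < i \<and> i < b"
proof (rule ccontr)
  assume neg: "\<not> ?thesis"
  have "m = m' \<or> m = Suc m' \<Longrightarrow> a \<noteq> i \<and> b \<noteq> i" using ind by (auto simp: indep_def)
  then consider "m < m'" | "Suc m' < m" | "i < a" | "b < i" | "m = Suc m'" "a < i" "i < b"
    using neg by linarith
  then have "lseg (CliqueB m a b) \<inter> lseg (MatchB m' i) = {}"
  proof cases
    case 1 then show ?thesis unfolding lseg_def src.simps dst.simps
      using v by (intro sep_Re B_level) auto
  next
    case 2 then show ?thesis unfolding lseg_def src.simps dst.simps
      using v by (intro sep_Re' B_level) auto
  next
    case 3 then show ?thesis unfolding lseg_def src.simps dst.simps
      using v by (intro sep_Im' B_row) auto
  next
    case 4 then show ?thesis unfolding lseg_def src.simps dst.simps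
      using v by (intro sep_Im B_row) auto
  next
    case 5
    have vs: "B m a \<in> verts" "B m b \<in> verts" "B m i \<in> verts" "B m' i \<in> verts" using v 5 by auto
    \<comment> \<open>The spacing \<open>G\<close> of the radii minus the depth of an arc still
      leaves \<open>2 * n\<close>.\<close>
    have steep: "Re (P (B m' i)) + 2 * real n \<le> Re (P (B m i))"
      using B_Re_bound[OF vs(3)] B_Re_bound[OF vs(4)] rad_less[of m' m] 5 G_bounds by auto
    have "seg (B m a) (B m b) \<inter> seg (B m' i) (B m i) = {}"
      by (rule parabola_chord_above_steep_segment[OF linear_Im linear_Re, of _ _ _ "rad m" _ "real n"])
        (use B_row[of a i m m] B_row[of a i m m'] B_row[of i b m m] B_row[of i b m' m] 5 vs B_parabola
           B_low[OF vs(3)] B_low[OF vs(4)] B_Im_bound[OF vs(3)] B_Im_bound[OF vs(4)] steep in auto)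
    then show ?thesis using 5 by (auto simp: lseg_def)
  qed
  then show False using meet by blast
qed

lemma CliqueB_Link:
  assumes v: "valid (CliqueB m' a b)" "valid (Link k m)" and ind: "indep (CliqueB m' a b) (Link k m)"
  shows "lseg (CliqueB m' a b) \<inter> lseg (Link k m) = {}"
proof -
  note k = valid_LinkD[OF v(2)]
  have "a < n" "b < n" "m' = m \<Longrightarrow> a \<noteq> n - 1 \<and> b \<noteq> n - 1" using v ind by (auto simp: indep_def)
  then consider "m' < m" | "m < m'" | "m' = m" "a < n - 1" "b < n - 1" by linarith
  then show ?thesis
  proof cases
    case 1 then show ?thesis unfolding lseg_def src.simps dst.simps
      using v k n2 by (intro sep_Re B_level B_left_A) auto
  next
    case 2 then show ?thesis unfolding lseg_def src.simps dst.simps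
      using v k n2 by (intro sep_Re' B_level A_left_B) auto
  next
    case 3 then show ?thesis unfolding lseg_def src.simps dst.simps
      using v k n2 by (intro sep_Im B_row B_below_A) auto
  qed
qed

lemma MatchB_MatchB:
  assumes v: "valid (MatchB m i)" "valid (MatchB m' i')" and ind: "indep (MatchB m i) (MatchB m' i')"
  shows "lseg (MatchB m i) \<inter> lseg (MatchB m' i') = {}"
proof -
  have "i = i' \<Longrightarrow> m \<noteq> m' \<and> Suc m \<noteq> m' \<and> Suc m' \<noteq> m" using ind by (auto simp: indep_def)
  then consider "i < i'" | "i' < i" | "Suc m < m'" | "Suc m' < m" by linarith
  then show ?thesis
  proof cases
    case 1 then show ?thesis unfolding lseg_def src.simps dst.simps
      using v by (intro sep_Im B_row) auto
  next
    case 2 then show ?thesis unfolding lseg_def src.simps dst.simps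
      using v by (intro sep_Im' B_row) auto
  next
    case 3 then show ?thesis unfolding lseg_def src.simps dst.simps
      using v by (intro sep_Re B_level) auto
  next
    case 4 then show ?thesis unfolding lseg_def src.simps dst.simps
      using v by (intro sep_Re' B_level) auto
  qed
qed

lemma MatchB_Link:
  assumes v: "valid (MatchB m' i)" "valid (Link k m)" and ind: "indep (MatchB m' i) (Link k m)"
  shows "lseg (MatchB m' i) \<inter> lseg (Link k m) = {}"
proof -
  note k = valid_LinkD[OF v(2)]
  have "i < n" "i = n - 1 \<Longrightarrow> m' \<noteq> m \<and> Suc m' \<noteq> m" using v ind by (auto simp: indep_def)
  then consider "i < n - 1" | "i = n - 1" "Suc m' < m" | "i = n - 1" "m < m'" by linarith
  then show ?thesis
  proof cases
    case 1 then show ?thesis unfolding lseg_def src.simps dst.simps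
      using v k n2 by (intro sep_Im B_row B_below_A) auto
  next
    case 2 then show ?thesis unfolding lseg_def src.simps dst.simps
      using v k n2 by (intro sep_Re B_level B_left_A) auto
  next
    case 3 then show ?thesis unfolding lseg_def src.simps dst.simps
      using v k n2 by (intro sep_Re' B_level A_left_B) auto
  qed
qed

text \<open>For sites \<open>k < k'\<close> the spacing gives \<open>k + 2 \<le> k'\<close>: links
  of \<open>k\<close> reach at most clique \<open>k\<close> of \<open>B\<close>, and links of
  \<open>k'\<close> begin at clique \<open>k' - 1\<close> or later.\<close>

lemma Link_Link:
  assumes v: "valid (Link k m)" "valid (Link k' m')" and ind: "indep (Link k m) (Link k' m')"
  shows "lseg (Link k m) \<inter> lseg (Link k' m') = {}"
proof -
  have *: "lseg (Link k m) \<inter> lseg (Link k' m') = {}"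
    if v: "valid (Link k m)" "valid (Link k' m')" and "k < k'" for k m k' m'
  proof -
    note k = valid_LinkD[OF v(1)] valid_LinkD[OF v(2)]
    have "k' \<noteq> Suc k" using v sites_spaced by auto
    then show ?thesis unfolding lseg_def src.simps dst.simps
      using v k n2 that by (intro sep_Re A_flare_right A_left_B B_left_A B_level) auto
  qed
  have "k \<noteq> k'" using ind by (auto simp: indep_def)
  then show ?thesis using *[of k m k' m'] *[of k' m' k m] v by (cases "k < k'") auto
qed

section \<open>Counting the crossings on an edge\<close>

definition meets :: "lab \<Rightarrow> lab \<Rightarrow> bool" where
  "meets l l' \<longleftrightarrow> valid l \<and> valid l' \<and> indep l l' \<and> lseg l \<inter> lseg l' \<noteq> {}"

lemma meets_sym: "meets l l' \<Longrightarrow> meets l' l"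
  using indep_sym by (auto simp: meets_def)

lemma MatchA_CliqueB: "valid (MatchA j i) \<Longrightarrow> valid (CliqueB m c d) \<Longrightarrow> lseg (MatchA j i) \<inter> lseg (CliqueB m c d) = {}"
  and MatchA_MatchB: "valid (MatchA j i) \<Longrightarrow> valid (MatchB m i') \<Longrightarrow> lseg (MatchA j i) \<inter> lseg (MatchB m i') = {}"
  using MatchA_B[of j i m c m d] MatchA_B[of j i m i' "Suc m" i'] by (simp_all add: lseg_def)

lemma not_meetsI:
  "(valid l \<Longrightarrow> valid l' \<Longrightarrow> indep l l' \<Longrightarrow> lseg l \<inter> lseg l' = {}) \<Longrightarrow> \<not> meets l l'"
  by (auto simp: meets_def)

lemma not_meets:
  "\<not> meets (CliqueA j a b) (Loop k i)" "\<not> meets (CliqueA j a b) (CliqueB m c d)"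
  "\<not> meets (CliqueA j a b) (MatchB m i)" "\<not> meets (CliqueA j a b) (Link k m)"
  "\<not> meets (MatchA j i) (MatchA j' i')" "\<not> meets (MatchA j i) (Loop k i')"
  "\<not> meets (MatchA j i) (CliqueB m c d)" "\<not> meets (MatchA j i) (MatchB m i')"
  "\<not> meets (MatchA j i) (Link k m)" "\<not> meets (Loop k i) (Loop k' i')"
  "\<not> meets (Loop k i) (CliqueB m c d)" "\<not> meets (Loop k i) (Link k' m)"
  "\<not> meets (CliqueB m a b) (Link k m')" "\<not> meets (MatchB m i) (MatchB m' i')"
  "\<not> meets (MatchB m i) (Link k m')" "\<not> meets (Link k m) (Link k' m')"
  by (rule not_meetsI,
      (rule CliqueA_Loop CliqueA_CliqueB CliqueA_MatchB CliqueA_Link MatchA_MatchA MatchA_Loop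
        MatchA_CliqueB MatchA_MatchB MatchA_Link Loop_Loop Loop_CliqueB Loop_Link CliqueB_Link
        MatchB_MatchB MatchB_Link Link_Link; assumption))+

lemma not_meets_sym: "\<not> meets l l' \<Longrightarrow> \<not> meets l' l"
  using meets_sym by blast

lemmas not_meets' = not_meets not_meets[THEN not_meets_sym]

text \<open>An interlacing chord has one end \<open>x\<close> strictly inside the range and the
  other end \<open>y\<close> outside it; \<open>min\<close> and \<open>max\<close> restore the order
  of the indices in its label.\<close>

lemma meets_CliqueA: "meets (CliqueA j a b) l \<Longrightarrow>
    l \<in> (\<lambda>(x, y). CliqueA j (min x y) (max x y)) ` ({a<..<b} \<times> ({..<n} - {a..b})) \<union> MatchA j ` {a<..<b}"
proof (cases l)
  case (CliqueA j' c d)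
  assume m: "meets (CliqueA j a b) l"
  then have "j = j' \<and> (a < c \<and> c < b \<and> b < d \<or> c < a \<and> a < d \<and> d < b)" "c < d" "d < n"
    using CliqueA_CliqueA[of j a b j' c d] CliqueA by (auto simp: meets_def)
  then have "l = (\<lambda>(x, y). CliqueA j (min x y) (max x y)) (c, d) \<and> (c, d) \<in> {a<..<b} \<times> ({..<n} - {a..b}) \<or>
      l = (\<lambda>(x, y). CliqueA j (min x y) (max x y)) (d, c) \<and> (d, c) \<in> {a<..<b} \<times> ({..<n} - {a..b})"
    using CliqueA by auto
  then show ?thesis by blast
next
  case (MatchA j' i)
  assume "meets (CliqueA j a b) l"
  then show ?thesis using CliqueA_MatchA[of j a b j' i] MatchA by (auto simp: meets_def)
qed (simp_all add: not_meets')

lemma meets_CliqueB: "meets (CliqueB m a b) l \<Longrightarrow>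
    l \<in> (\<lambda>(x, y). CliqueB m (min x y) (max x y)) ` ({a<..<b} \<times> ({..<n} - {a..b})) \<union> MatchB m ` {a<..<b}"
proof (cases l)
  case (CliqueB m' c d)
  assume m: "meets (CliqueB m a b) l"
  then have "m = m' \<and> (a < c \<and> c < b \<and> b < d \<or> c < a \<and> a < d \<and> d < b)" "c < d" "d < n"
    using CliqueB_CliqueB[of m a b m' c d] CliqueB by (auto simp: meets_def)
  then have "l = (\<lambda>(x, y). CliqueB m (min x y) (max x y)) (c, d) \<and> (c, d) \<in> {a<..<b} \<times> ({..<n} - {a..b}) \<or>
      l = (\<lambda>(x, y). CliqueB m (min x y) (max x y)) (d, c) \<and> (d, c) \<in> {a<..<b} \<times> ({..<n} - {a..b})"
    using CliqueB by auto
  then show ?thesis by blast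
next
  case (MatchB m' i)
  assume "meets (CliqueB m a b) l"
  then show ?thesis using CliqueB_MatchB[of m a b m' i] MatchB by (auto simp: meets_def)
qed (simp_all add: not_meets')

lemma meets_MatchA: "meets (MatchA j i) l \<Longrightarrow> l \<in> (\<lambda>(a, b). CliqueA j a b) ` ({..<i} \<times> {i<..<n})"
proof (cases l)
  case (CliqueA j' a b)
  assume "meets (MatchA j i) l"
  then have "meets (CliqueA j' a b) (MatchA j i)" using CliqueA meets_sym by blast
  then have "j' = j" "a < i" "i < b" "b < n" using CliqueA_MatchA[of j' a b j i] by (auto simp: meets_def)
  then show ?thesis using CliqueA by force
qed (simp_all add: not_meets')

lemma meets_MatchB: "meets (MatchB m i) l \<Longrightarrow>
    l \<in> insert (Loop (Suc m) (n - 1)) ((\<lambda>(a, b). CliqueB m a b) ` ({..<i} \<times> {i<..<n}))"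
proof (cases l)
  case (CliqueB m' a b)
  assume "meets (MatchB m i) l"
  then have "meets (CliqueB m' a b) (MatchB m i)" using CliqueB meets_sym by blast
  then have "m' = m" "a < i" "i < b" "b < n" using CliqueB_MatchB[of m' a b m i] by (auto simp: meets_def)
  then show ?thesis using CliqueB by force
next
  case (Loop k i')
  assume "meets (MatchB m i) l"
  then have "meets (Loop k i') (MatchB m i)" using Loop meets_sym by blast
  then show ?thesis using Loop_MatchB[of k i' m i] Loop by (auto simp: meets_def)
qed (simp_all add: not_meets')

lemma meets_Loop: "meets (Loop k i) l \<Longrightarrow> l \<in> MatchB (k - 1) ` {..<n}"
proof (cases l)
  case (MatchB m i')
  assume "meets (Loop k i) l"
  then show ?thesis using Loop_MatchB[of k i m i'] MatchB by (auto simp: meets_def)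
qed (simp_all add: not_meets')

lemma meets_Link: "\<not> meets (Link k m) l"
  by (cases l) (simp_all add: not_meets')

lemma card_meets:
  assumes q: "n \<le> 2 * q" and v: "valid l"
  shows "finite {l'. meets l l'} \<and> card {l'. meets l l'} \<le> q * q"
proof -
  have *: ?thesis if "{l'. meets l l'} \<subseteq> X" "finite X" "card X \<le> q * q" for X
    using that by (meson card_mono finite_subset le_trans)
  have clique: "card (f ` ({a<..<b} \<times> ({..<n} - {a..b})) \<union> g ` {a<..<b}) \<le> q * q"
    if "a < b" "b < n" for f :: "nat \<times> nat \<Rightarrow> lab" and g a b
  proof -
    define d where "d = b - a - 1"
    have "card ({..<n} - {a..b}) = n - 2 - d"
      using that by (subst card_Diff_subset) (auto simp: d_def)
    then have "card (f ` ({a<..<b} \<times> ({..<n} - {a..b}))) \<le> d * (n - 2 - d)"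
      using card_image_le[of "{a<..<b} \<times> ({..<n} - {a..b})" f] by (simp add: card_cartesian_product d_def)
    moreover have "card (g ` {a<..<b}) \<le> d" using card_image_le[of "{a<..<b}" g] by (simp add: d_def)
    ultimately have "card (f ` ({a<..<b} \<times> ({..<n} - {a..b})) \<union> g ` {a<..<b}) \<le> d * (n - 2 - d) + d"
      by (meson add_mono card_Un_le le_trans)
    \<comment> \<open>Chords and matching edges together: the factors add up to
      \<open>n - 1\<close>, as \<open>mult_le_square\<close> requires.\<close>
    also have "\<dots> = d * (n - 2 - d + 1)" by simp
    also have "\<dots> + q \<le> q * q" using that q by (intro mult_le_square) (auto simp: d_def)
    finally show ?thesis by simp
  qed
  have match: "card (f ` ({..<i} \<times> {i<..<n})) + q \<le> q * q" if "i < n" for f :: "nat \<times> nat \<Rightarrow> lab" and i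
  proof -
    have "card (f ` ({..<i} \<times> {i<..<n})) \<le> i * (n - 1 - i)"
      using card_image_le[of "{..<i} \<times> {i<..<n}" f] by (simp add: card_cartesian_product)
    also have "\<dots> + q \<le> q * q" using that q by (intro mult_le_square) auto
    finally show ?thesis by simp
  qed
  show ?thesis
  proof (cases l)
    case (CliqueA j a b)
    let ?X = "(\<lambda>(x, y). CliqueA j (min x y) (max x y)) ` ({a<..<b} \<times> ({..<n} - {a..b})) \<union> MatchA j ` {a<..<b}"
    have "{l'. meets l l'} \<subseteq> ?X" using meets_CliqueA CliqueA by blast
    moreover have "card ?X \<le> q * q" using clique v CliqueA by simp
    ultimately show ?thesis by (intro *[of ?X]) auto
  next
    case (CliqueB m a b)
    let ?X = "(\<lambda>(x, y). CliqueB m (min x y) (max x y)) ` ({a<..<b} \<times> ({..<n} - {a..b})) \<union> MatchB m ` {a<..<b}"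
    have "{l'. meets l l'} \<subseteq> ?X" using meets_CliqueB CliqueB by blast
    moreover have "card ?X \<le> q * q" using clique v CliqueB by simp
    ultimately show ?thesis by (intro *[of ?X]) auto
  next
    case (MatchA j i)
    let ?X = "(\<lambda>(a, b). CliqueA j a b) ` ({..<i} \<times> {i<..<n})"
    have "{l'. meets l l'} \<subseteq> ?X" using meets_MatchA MatchA by blast
    moreover have "card ?X + q \<le> q * q" using match v MatchA by simp
    ultimately show ?thesis by (intro *[of ?X]) auto
  next
    case (MatchB m i)
    let ?X = "(\<lambda>(a, b). CliqueB m a b) ` ({..<i} \<times> {i<..<n})"
    \<comment> \<open>The spare \<open>q\<close> in the bound \<open>match\<close> pays for the one
      additional loop.\<close>
    have "card (insert (Loop (Suc m) (n - 1)) ?X) \<le> card ?X + 1"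
      by (subst card_insert_if) auto
    moreover have "card ?X + q \<le> q * q" using match v MatchB by simp
    ultimately have "card (insert (Loop (Suc m) (n - 1)) ?X) \<le> q * q" using q n2 by linarith
    moreover have "{l'. meets l l'} \<subseteq> insert (Loop (Suc m) (n - 1)) ?X" using meets_MatchB MatchB by blast
    ultimately show ?thesis by (intro *[of "insert (Loop (Suc m) (n - 1)) ?X"]) auto
  next
    case (Loop k i)
    \<comment> \<open>Existence of a loop gives \<open>2 \<le> q\<close>, which turns
      \<open>n \<le> 2 * q\<close> into \<open>n \<le> q * q\<close>.\<close>
    have "3 \<le> n" using v Loop by simp
    then have "2 \<le> q" using q by linarith
    then have "n \<le> q * q" using q mult_le_mono1[of 2 q q] by linarith
    then have "card (MatchB (k - 1) ` {..<n}) \<le> q * q"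
      using card_image_le[of "{..<n}" "MatchB (k - 1)"] by simp
    moreover have "{l'. meets l l'} \<subseteq> MatchB (k - 1) ` {..<n}" using meets_Loop Loop by blast
    ultimately show ?thesis by (intro *[of "MatchB (k - 1) ` {..<n}"]) auto
  next
    case (Link k m)
    then show ?thesis using meets_Link by simp
  qed
qed

section \<open>The crossing bound for the whole drawing\<close>

definition pos :: "nat \<Rightarrow> complex" where "pos v = P (from_nat v)"

lemma pos_to_nat [simp]: "pos (to_nat v) = P v"
  by (simp add: pos_def)

sublocale straight_drawing V E pos
proof
  show "simple_graph V E" by (rule simple_graph)
  show "inj_on pos V" using P_inj by (auto simp: V_def inj_on_def)
  have "pos ` V = P ` verts" by (auto simp: V_def image_image)
  then show "generic (pos ` V)" using P_generic by simp
qed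

lemma hull_edge: "convex hull (pos ` edge l) = lseg l"
  by (simp add: edge_def lseg_def segment_convex_hull)

lemma k_plane_ladders:
  assumes q: "n \<le> 2 * q" "q * q \<le> k"
  shows "k_plane k V E pos curve"
proof (rule k_plane_curve)
  fix e assume "e \<in> E"
  then obtain l where l: "valid l" "e = edge l" by (auto simp: E_def)
  let ?X = "{e' \<in> E. e \<inter> e' = {} \<and> convex hull (pos ` e) \<inter> convex hull (pos ` e') \<noteq> {}}"
  have "?X \<subseteq> edge ` {l'. meets l l'}"
  proof
    fix e' assume e': "e' \<in> ?X"
    then obtain l' where l': "valid l'" "e' = edge l'" by (auto simp: E_def)
    have "indep l l'" using e' l l' by (auto simp: indep_def edge_def)
    then have "meets l l'" using e' l l' hull_edge by (auto simp: meets_def)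
    then show "e' \<in> edge ` {l'. meets l l'}" using l' by blast
  qed
  then have "card ?X \<le> card {l'. meets l l'}" using card_meets[OF q(1) l(1)] by (meson surj_card_le)
  then show "card ?X \<le> k" using card_meets[OF q(1) l(1)] q(2) by linarith
qed

lemma lseg_subset_drawing: "valid l \<Longrightarrow> lseg l \<subseteq> drawing_set V E pos curve"
  unfolding drawing_set_def using path_image_curve[of "edge l"] hull_edge[of l] by (auto simp: E_def)

section \<open>The nested quadrilaterals in the drawing\<close>

lemma orient_level:
  assumes v: "A j 0 \<in> verts" "A j (n - 1) \<in> verts" "A j' i \<in> verts"
  shows "j < j' \<Longrightarrow> 0 < orient (P (A j 0)) (P (A j (n - 1))) (P (A j' i))"
    and "j' < j \<Longrightarrow> orient (P (A j 0)) (P (A j (n - 1))) (P (A j' i)) < 0"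
proof -
  define s t x where "s = Re (P (A j 0))" and "t = Re (P (A j (n - 1)))" and "x = Re (P (A j' i))"
  \<comment> \<open>The height of the point above the line; \<open>t + s\<close> is the slope of the
    chord of the parabola.\<close>
  define D where "D = (Im (P (A j' i)) - Im (P (A j 0))) - (t + s) * (x - s)"
  have st: "s < t" using A_row[OF _ v(1,2)] n2 by (simp add: s_def t_def)
  \<comment> \<open>The unit intervals of the two ends are mirror images, so the slope is at most 1.
    Over a width of \<open>2 * W\<close> the line changes height by at most \<open>2 * W\<close>,
    less than the gap \<open>4 * W\<close> between levels.\<close>
  have "\<bar>t + s\<bar> \<le> 1" using A_low[OF v(1)] A_low[OF v(2)] n2 by (auto simp: s_def t_def)
  moreover have "\<bar>x - s\<bar> \<le> 2 * W" using A_Re_bound[OF v(1)] A_Re_bound[OF v(3)] by (simp add: s_def x_def)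
  ultimately have b: "\<bar>(t + s) * (x - s)\<bar> \<le> 1 * (2 * W)" unfolding abs_mult by (intro mult_mono) auto
  have W: "0 < W" using G_le_W G_bounds by linarith
  have o: "orient (P (A j 0)) (P (A j (n - 1))) (P (A j' i)) = (t - s) * D"
    using A_parabola[OF v(1)] A_parabola[OF v(2)]
    by (simp add: orient_def D_def s_def t_def x_def power2_eq_square algebra_simps)
  show "0 < orient (P (A j 0)) (P (A j (n - 1))) (P (A j' i))" if "j < j'"
  proof -
    have "0 < D" unfolding D_def using A_gap[OF that v(1,3)] b W by linarith
    then show ?thesis using o st by simp
  qed
  show "orient (P (A j 0)) (P (A j (n - 1))) (P (A j' i)) < 0" if "j' < j"
  proof -
    have "D < 0" unfolding D_def using A_gap[OF that v(3,1)] b W by linarith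
    then show ?thesis using o st by (simp add: mult_pos_neg)
  qed
qed

text \<open>The corners run counterclockwise from the lower left one; \<open>qc k\<close> is the
  position of the site when \<open>k\<close> is in \<open>sites\<close>.\<close>

abbreviation qa :: "nat \<Rightarrow> complex" where "qa k \<equiv> P (A (- 1 - int k) 0)"
abbreviation qb :: "nat \<Rightarrow> complex" where "qb k \<equiv> P (A (- 1 - int k) (n - 1))"
abbreviation qc :: "nat \<Rightarrow> complex" where "qc k \<equiv> P (A (int k) (n - 1))"
abbreviation qd :: "nat \<Rightarrow> complex" where "qd k \<equiv> P (A (int k) 0)"

lemma level_in_strip:
  assumes "k \<le> K" "- 1 - int k < j" "j < int k" "A j i \<in> verts"
  shows "0 < orient (qa k) (qb k) (P (A j i))" "0 < orient (qc k) (qd k) (P (A j i))"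
proof -
  have v: "A (- 1 - int k) 0 \<in> verts" "A (- 1 - int k) (n - 1) \<in> verts" "A (int k) 0 \<in> verts" "A (int k) (n - 1) \<in> verts"
    using assms n2 by auto
  show "0 < orient (qa k) (qb k) (P (A j i))" using orient_level(1)[OF v(1,2) assms(4)] assms by blast
  show "0 < orient (qc k) (qd k) (P (A j i))"
    using orient_level(2)[OF v(3,4) assms(4)] assms orient_swap[of "qc k" "qd k"] by simp
qed

lemma convex_quad_level:
  assumes "k \<le> K" shows "convex_quad (qa k) (qb k) (qc k) (qd k)"
proof -
  have v: "A (- 1 - int k) 0 \<in> verts" "A (- 1 - int k) (n - 1) \<in> verts" "A (int k) 0 \<in> verts" "A (int k) (n - 1) \<in> verts"
    using assms n2 by auto
  have k: "- 1 - int k < int k" by simp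
  have up: "0 < orient (qa k) (qb k) (qc k)" "0 < orient (qa k) (qb k) (qd k)"
    using orient_level(1)[OF v(1,2) v(4) k] orient_level(1)[OF v(1,2) v(3) k] .
  have down: "0 < orient (qc k) (qd k) (qa k)" "0 < orient (qc k) (qd k) (qb k)"
    using orient_level(2)[OF v(3,4) v(1) k] orient_level(2)[OF v(3,4) v(2) k] orient_swap[of "qc k" "qd k"] by simp_all
  show ?thesis unfolding convex_quad_def
    using up down orient_cycle[of "qb k" "qc k" "qd k"] orient_cycle[of "qd k" "qa k" "qb k"] by simp
qed

text \<open>The almost horizontal sides separate by level, the two long sides by the flaring of the
  outermost rows.\<close>

lemma nested_quads:
  assumes "k < K"
  shows "{qa k, qb k, qc k, qd k} \<subseteq> quad_interior (qa (Suc k)) (qb (Suc k)) (qc (Suc k)) (qd (Suc k))"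
proof -
  have "P (A j i) \<in> quad_interior (qa (Suc k)) (qb (Suc k)) (qc (Suc k)) (qd (Suc k))"
    if v: "A j i \<in> verts" and j: "j = int k \<or> j = - 1 - int k" for j i
  proof -
    have d: "depth j < Suc k" "- 1 - int (Suc k) < j" "j < int (Suc k)" using j by auto
    have "0 < orient (qb (Suc k)) (qc (Suc k)) (P (A j i))"
      using d v assms n2 by (intro orient_right_of A_flare_right A_level) (auto simp del: of_nat_Suc)
    moreover have "0 < orient (qd (Suc k)) (qa (Suc k)) (P (A j i))"
      using d v assms n2 by (intro orient_left_of A_flare_left A_level) (auto simp del: of_nat_Suc)
    ultimately show ?thesis using level_in_strip[of "Suc k" j i] d v assms by (simp add: quad_interior_def)
  qed
  then show ?thesis using assms n2 by auto
qed

lemma face_dist_sites: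
  assumes n: "3 \<le> n" and k: "k1 \<in> sites" "k2 \<in> sites" "k1 < k2"
  shows "enat (k2 - k1) \<le> face_dist V E pos curve (to_nat (A (int k1) (n - 1))) (to_nat (A (int k2) (n - 1)))"
    "enat (k2 - k1) \<le> face_dist V E pos curve (to_nat (A (int k2) (n - 1))) (to_nat (A (int k1) (n - 1)))"
proof -
  \<comment> \<open>Two sides are clique edges between the outermost rows, the other two are loops,
    which exist because \<open>3 \<le> n\<close>.\<close>
  have sides: "closed_segment (qa k) (qb k) \<union> closed_segment (qb k) (qc k) \<union>
      closed_segment (qc k) (qd k) \<union> closed_segment (qd k) (qa k) \<subseteq> drawing_set V E pos curve"
    if "k \<in> {1..K}" for k
    using lseg_subset_drawing[of "CliqueA (- 1 - int k) 0 (n - 1)"] lseg_subset_drawing[of "CliqueA (int k) 0 (n - 1)"]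
      lseg_subset_drawing[of "Loop k 0"] lseg_subset_drawing[of "Loop k (n - 1)"] that n
    by (simp add: lseg_def closed_segment_commute)
  note * = face_dist_nested_quads[of K qa qb qc qd V E pos curve k1 k2]
  show "enat (k2 - k1) \<le> face_dist V E pos curve (to_nat (A (int k1) (n - 1))) (to_nat (A (int k2) (n - 1)))"
    "enat (k2 - k1) \<le> face_dist V E pos curve (to_nat (A (int k2) (n - 1))) (to_nat (A (int k1) (n - 1)))"
    using k site_bounds[of k1] site_bounds[of k2] convex_quad_level sides nested_quads
    by (intro *; auto)+
qed

end

section \<open>Choice of the parameters\<close>

theorem mainTheorem15:
  fixes k p r :: nat
  assumes "0 < k" and "0 < p" and "0 < r"
    and "real p < 2 * of_int \<lfloor>sqrt (real k)\<rfloor>"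
  shows "\<exists>(V :: nat set) (E :: nat set set) (pos :: nat \<Rightarrow> complex) (gam :: nat set \<Rightarrow> real \<Rightarrow> complex) S.
           k_plane k V E pos gam \<and> unique_min_vertex_cut V E S \<and> card S = p \<and>
           (\<forall>s1\<in>S. \<forall>s2\<in>S. s1 \<noteq> s2 \<longrightarrow> enat r \<le> face_dist V E pos gam s1 s2)"
proof -
  \<comment> \<open>With \<open>n = p + 1\<close>, the hypothesis on \<open>p\<close> becomes
    \<open>n \<le> 2 * q\<close>, and \<open>q * q \<le> k\<close>.\<close>
  define q where "q = nat \<lfloor>sqrt (real k)\<rfloor>"
  have q_floor: "real q = of_int \<lfloor>sqrt (real k)\<rfloor>" by (simp add: q_def)
  have "p < 2 * q" using assms(4) q_floor by linarith
  have "real q \<le> sqrt (real k)" using q_floor by linarith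
  then have "real q * real q \<le> real k" using real_le_rsqrt[of "real q" "real k"]
    by (metis of_nat_0_le_iff power2_eq_square real_sqrt_le_iff real_sqrt_pow2 power_mono)
  then have "q * q \<le> k" by (metis of_nat_le_iff of_nat_mult)
  \<comment> \<open>Multiples of \<open>r + 1\<close> differ by more than \<open>r\<close>, which
    gives the face distance; as \<open>r\<close> is positive, they are never consecutive.\<close>
  define sites where "sites = (\<lambda>c. c * (r + 1)) ` {1..p}"
  interpret ladders "p + 1" "p * (r + 1)" sites
  proof
    show "2 \<le> p + 1" using assms by simp
    show "sites \<subseteq> {1..p * (r + 1)}"
    proof
      fix k assume "k \<in> sites"
      then obtain c where c: "k = c * (r + 1)" "1 \<le> c" "c \<le> p" by (auto simp: sites_def)
      then show "k \<in> {1..p * (r + 1)}" using mult_le_mono1[OF c(3), of "r + 1"] by simp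
    qed
    have "inj_on (\<lambda>c. c * (r + 1)) {1..p}" by (rule inj_onI) (metis add_is_0 mult_right_cancel one_neq_zero)
    then show "card sites = p + 1 - 1" unfolding sites_def by (subst card_image) auto
    show "Suc k \<notin> sites" if "k \<in> sites" for k
    proof
      assume "Suc k \<in> sites"
      then have "r + 1 dvd Suc k" "r + 1 dvd k" using that unfolding sites_def by (metis dvd_triv_right imageE)+
      then have "r + 1 dvd Suc k - k" by (rule dvd_diff_nat)
      then show False using assms(3) by simp
    qed
  qed
  obtain P where P: "\<forall>v\<in>verts. P v \<in> arc_of v" "inj_on P verts" "generic (P ` verts)"
    using placement_exists by blast
  interpret placed_ladders "p + 1" "p * (r + 1)" sites P
    by unfold_locales (use P in auto)
  have "enat r \<le> face_dist V E pos curve s1 s2" if s: "s1 \<in> S" "s2 \<in> S" "s1 \<noteq> s2" for s1 s2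
  proof -
    \<comment> \<open>Two distinct members of \<open>S\<close> force \<open>2 \<le> p\<close>, so
      that the loops exist.\<close>
    have "finite S" "card {s1, s2} = 2" using s card_S assms(2) by (auto intro: card_ge_0_finite)
    then have "2 \<le> p" using card_mono[of S "{s1, s2}"] s card_S by auto
    then have n3: "3 \<le> p + 1" by simp
    obtain k1 k2 where k: "k1 \<in> sites" "k2 \<in> sites" "k1 \<noteq> k2" "s1 = to_nat (A (int k1) (p + 1 - 1))" "s2 = to_nat (A (int k2) (p + 1 - 1))"
      using s unfolding S_def by blast
    have gap: "r \<le> y - x" if xy: "x \<in> sites" "y \<in> sites" "x < y" for x y
    proof -
      obtain c d where cd: "x = c * (r + 1)" "y = d * (r + 1)"
        using xy unfolding sites_def by (metis imageE)
      then have "c < d" using xy(3) by (metis mult_less_cancel2)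
      then have "(c + 1) * (r + 1) \<le> d * (r + 1)" by (intro mult_le_mono1) simp
      then show ?thesis using cd by simp
    qed
    show ?thesis
    proof (cases "k1 < k2")
      case True
      then have "enat r \<le> enat (k2 - k1)" using gap k by simp
      then show ?thesis using face_dist_sites(1)[OF n3 k(1,2) True] k(4,5) by (metis order_trans)
    next
      case False
      then have lt: "k2 < k1" using k(3) by simp
      then have "enat r \<le> enat (k1 - k2)" using gap k by simp
      then show ?thesis using face_dist_sites(2)[OF n3 k(2,1) lt] k(4,5) by (metis order_trans)
    qed
  qed
  moreover have "k_plane k V E pos curve"
    using k_plane_ladders[of q k] \<open>p < 2 * q\<close> \<open>q * q \<le> k\<close> by simp
  moreover have "card S = p" using card_S by simp
  ultimately show ?thesis using unique_min_cut by blast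
qed

end
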